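(* Let $T_1,T_2$ be contractions on complex Hilbert spaces $\mathbb{H}_1,\mathbb{H}_2$ respectively, with $\mathbb{T}\subseteq\sigma(T_i)$ for $i=1,2$. Then the operator space structure on $\ell^1(2)$ induced by the isometry $f:\ell^1(2)\to\mathcal{B}(\mathbb{H}_1\otimes\mathbb{H}_2)$, $f(a_1,a_2)=a_1T_1\otimes I_{\mathbb{H}_2}+a_2I_{\mathbb{H}_1}\otimes T_2$, is completely isometric to the MIN structure: $f$ is a complete isometry from $\mathrm{MIN}(\ell^1(2))$ onto its image.
   Context: $\ell^1(2)$ is $\mathbb{C}^2$ with the norm $|a_1|+|a_2|$; $\mathbb{T}$ is the unit circle and $\sigma$ denotes spectrum. The MIN operator space structure on a normed space $W$ is given, for $(v_{ij})\in M_k(W)$, by $\|(v_{ij})\|_{MIN}=\sup\{\|(g(v_{ij}))\|_{M_k}: g\in W^*,\ \|g\|\le 1\}$. The operator space structure induced by an isometry $f:W\to\mathcal{B}(\mathbb{K})$ has matrix norms $\|(v_{ij})\|_k=\|(f(v_{ij}))\|_{\mathcal{B}(\mathbb{K}^k)}$. A linear map is a complete isometry if all its amplifications $f\otimes I_k$, $k\in\mathbb{N}$, are isometries. *)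

theory Defs
  imports "HOL-Analysis.Analysis"
begin

section \<open>Complex normed spaces and complex Hilbert spaces\<close>

class complex_vector = real_vector +
  fixes scaleC :: "complex \<Rightarrow> 'a \<Rightarrow> 'a"  (infixr "*\<^sub>C" 75)
  assumes scaleC_add_right: "c *\<^sub>C (x + y) = c *\<^sub>C x + c *\<^sub>C y"
    and scaleC_add_left: "(c + d) *\<^sub>C x = c *\<^sub>C x + d *\<^sub>C x"
    and scaleC_scaleC: "c *\<^sub>C (d *\<^sub>C x) = (c * d) *\<^sub>C x"
    and scaleC_one: "1 *\<^sub>C x = x"
    and scaleR_scaleC: "r *\<^sub>R x = complex_of_real r *\<^sub>C x"

class complex_normed_vector = complex_vector + real_normed_vector +
  assumes norm_scaleC: "norm (c *\<^sub>C x) = cmod c * norm x"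

text \<open>The inner product is conjugate linear in its first argument.\<close>

class complex_inner = complex_normed_vector +
  fixes cinner :: "'a \<Rightarrow> 'a \<Rightarrow> complex"
  assumes cinner_commute: "cinner x y = cnj (cinner y x)"
    and cinner_add_right: "cinner x (y + z) = cinner x y + cinner x z"
    and cinner_scaleC_right: "cinner x (c *\<^sub>C y) = c * cinner x y"
    and cinner_self_nonneg: "0 \<le> Re (cinner x x)"
    and norm_eq_sqrt_cinner: "norm x = sqrt (Re (cinner x x))"

class chilbert_space = complex_inner + complete_space

instantiation complex :: chilbert_space
begin

definition scaleC_complex :: "complex \<Rightarrow> complex \<Rightarrow> complex"
  where "scaleC_complex c z = c * z"

definition cinner_complex :: "complex \<Rightarrow> complex \<Rightarrow> complex"
  where "cinner_complex w z = cnj w * z"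

instance
proof
  fix z :: complex
  show "norm z = sqrt (Re (cinner z z))"
    by (simp add: cinner_complex_def cmod_def power2_eq_square)
qed (auto simp: scaleC_complex_def cinner_complex_def algebra_simps norm_mult scaleR_conv_of_real)

end

definition clinear :: "('a::complex_vector \<Rightarrow> 'b::complex_vector) \<Rightarrow> bool"
  where "clinear f \<longleftrightarrow>
    (\<forall>x y. f (x + y) = f x + f y) \<and> (\<forall>c x. f (c *\<^sub>C x) = c *\<^sub>C f x)"


section \<open>Bounded complex-linear maps\<close>

typedef (overloaded) ('a, 'b) cblinfun  ("(_ \<Rightarrow>\<^sub>C\<^sub>L /_)" [22, 21] 21) =
  "{f :: 'a::complex_normed_vector \<Rightarrow> 'b::complex_normed_vector. clinear f \<and> bounded_linear f}"
  morphisms cblinfun_apply Cblinfun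
proof
  have "c *\<^sub>C (0::'b) = 0" for c
    using scaleC_add_right[of c "0::'b" 0] by simp
  then show "(\<lambda>x. 0) \<in> {f :: 'a \<Rightarrow> 'b. clinear f \<and> bounded_linear f}"
    by (simp add: clinear_def bounded_linear_zero)
qed

setup_lifting type_definition_cblinfun

lemma scaleC_zero_right [simp]: "c *\<^sub>C (0::'a::complex_vector) = 0"
  using scaleC_add_right[of c "0::'a" 0] by simp

lemma scaleC_minus_right: "c *\<^sub>C (- x) = - (c *\<^sub>C (x::'a::complex_vector))"
  using scaleC_add_right[of c "- x" x] by (simp add: eq_neg_iff_add_eq_0)

lemma scaleC_diff_right: "c *\<^sub>C (x - y) = c *\<^sub>C x - c *\<^sub>C (y::'a::complex_vector)"
  using scaleC_add_right[of c x "- y"] by (simp add: scaleC_minus_right)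

lemma scaleC_scaleR_commute: "c *\<^sub>C (r *\<^sub>R x) = r *\<^sub>R (c *\<^sub>C (x::'a::complex_vector))"
  by (simp add: scaleR_scaleC scaleC_scaleC mult.commute)

lemma bounded_linear_scaleC: "bounded_linear (\<lambda>x::'a::complex_normed_vector. c *\<^sub>C x)"
  by (rule bounded_linear_intro[where K = "cmod c"])
    (simp_all add: scaleC_add_right scaleC_scaleR_commute norm_scaleC mult.commute)

lemma onorm_scaleC:
  fixes f :: "'a::real_normed_vector \<Rightarrow> 'b::complex_normed_vector"
  assumes "bounded_linear f"
  shows "onorm (\<lambda>x. c *\<^sub>C f x) = cmod c * onorm f"
proof -
  have "onorm (\<lambda>x. c *\<^sub>C f x) = onorm (\<lambda>x. cmod c *\<^sub>R f x)"
    by (simp add: onorm_def norm_scaleC)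
  then show ?thesis
    using onorm_scaleR[OF assms, of "cmod c"] by simp
qed

instantiation cblinfun :: (complex_normed_vector, complex_normed_vector) complex_normed_vector
begin

lift_definition norm_cblinfun :: "'a \<Rightarrow>\<^sub>C\<^sub>L 'b \<Rightarrow> real" is onorm .

lift_definition zero_cblinfun :: "'a \<Rightarrow>\<^sub>C\<^sub>L 'b" is "\<lambda>x. 0"
  by (simp add: clinear_def)

lift_definition plus_cblinfun :: "'a \<Rightarrow>\<^sub>C\<^sub>L 'b \<Rightarrow> 'a \<Rightarrow>\<^sub>C\<^sub>L 'b \<Rightarrow> 'a \<Rightarrow>\<^sub>C\<^sub>L 'b"
  is "\<lambda>f g x. f x + g x"
  by (auto simp: clinear_def scaleC_add_right bounded_linear_add)

lift_definition minus_cblinfun :: "'a \<Rightarrow>\<^sub>C\<^sub>L 'b \<Rightarrow> 'a \<Rightarrow>\<^sub>C\<^sub>L 'b \<Rightarrow> 'a \<Rightarrow>\<^sub>C\<^sub>L 'b"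
  is "\<lambda>f g x. f x - g x"
  by (auto simp: clinear_def scaleC_diff_right bounded_linear_sub)

lift_definition uminus_cblinfun :: "'a \<Rightarrow>\<^sub>C\<^sub>L 'b \<Rightarrow> 'a \<Rightarrow>\<^sub>C\<^sub>L 'b" is "\<lambda>f x. - f x"
  by (auto simp: clinear_def scaleC_minus_right bounded_linear_minus)

lift_definition scaleR_cblinfun :: "real \<Rightarrow> 'a \<Rightarrow>\<^sub>C\<^sub>L 'b \<Rightarrow> 'a \<Rightarrow>\<^sub>C\<^sub>L 'b" is "\<lambda>r f x. r *\<^sub>R f x"
  by (auto simp: clinear_def scaleC_scaleR_commute scaleR_add_right
      intro: bounded_linear_compose[OF bounded_linear_scaleR_right])

lift_definition scaleC_cblinfun :: "complex \<Rightarrow> 'a \<Rightarrow>\<^sub>C\<^sub>L 'b \<Rightarrow> 'a \<Rightarrow>\<^sub>C\<^sub>L 'b" is "\<lambda>c f x. c *\<^sub>C f x"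
  by (auto simp: clinear_def scaleC_add_right scaleC_scaleC mult.commute
      intro: bounded_linear_compose[OF bounded_linear_scaleC])

definition dist_cblinfun :: "'a \<Rightarrow>\<^sub>C\<^sub>L 'b \<Rightarrow> 'a \<Rightarrow>\<^sub>C\<^sub>L 'b \<Rightarrow> real"
  where "dist_cblinfun a b = norm (a - b)"

definition uniformity_cblinfun :: "(('a \<Rightarrow>\<^sub>C\<^sub>L 'b) \<times> ('a \<Rightarrow>\<^sub>C\<^sub>L 'b)) filter"
  where "uniformity_cblinfun = (INF e\<in>{0 <..}. principal {(x, y). dist x y < e})"

definition open_cblinfun :: "('a \<Rightarrow>\<^sub>C\<^sub>L 'b) set \<Rightarrow> bool"
  where "open_cblinfun S = (\<forall>x\<in>S. \<forall>\<^sub>F (x', y) in uniformity. x' = x \<longrightarrow> y \<in> S)"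

definition sgn_cblinfun :: "'a \<Rightarrow>\<^sub>C\<^sub>L 'b \<Rightarrow> 'a \<Rightarrow>\<^sub>C\<^sub>L 'b"
  where "sgn_cblinfun x = inverse (norm x) *\<^sub>R x"

instance
proof
  fix f g h :: "'a \<Rightarrow>\<^sub>C\<^sub>L 'b" and r q :: real and c d :: complex
  show "f + g + h = f + (g + h)" by transfer (simp add: add.assoc)
  show "f + g = g + f" by transfer (simp add: add.commute)
  show "0 + f = f" by transfer simp
  show "- f + f = 0" by transfer simp
  show "f - g = f + - g" by transfer simp
  show "r *\<^sub>R (f + g) = r *\<^sub>R f + r *\<^sub>R g" by transfer (simp add: scaleR_add_right)
  show "(r + q) *\<^sub>R f = r *\<^sub>R f + q *\<^sub>R f" by transfer (simp add: scaleR_add_left)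
  show "r *\<^sub>R (q *\<^sub>R f) = (r * q) *\<^sub>R f" by transfer simp
  show "1 *\<^sub>R f = f" by transfer simp
  show "c *\<^sub>C (f + g) = c *\<^sub>C f + c *\<^sub>C g" by transfer (simp add: scaleC_add_right)
  show "(c + d) *\<^sub>C f = c *\<^sub>C f + d *\<^sub>C f" by transfer (simp add: scaleC_add_left)
  show "c *\<^sub>C (d *\<^sub>C f) = (c * d) *\<^sub>C f" by transfer (simp add: scaleC_scaleC)
  show "1 *\<^sub>C f = f" by transfer (simp add: scaleC_one)
  show "r *\<^sub>R f = complex_of_real r *\<^sub>C f" by transfer (simp add: scaleR_scaleC)
  show "norm f = 0 \<longleftrightarrow> f = 0" by transfer (auto simp: onorm_eq_0 fun_eq_iff)
  show "norm (f + g) \<le> norm f + norm g" by transfer (simp add: onorm_triangle)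
  show "norm (r *\<^sub>R f) = \<bar>r\<bar> * norm f" by transfer (simp add: onorm_scaleR)
  show "norm (c *\<^sub>C f) = cmod c * norm f" by transfer (simp add: onorm_scaleC)
qed (simp_all add: dist_cblinfun_def open_cblinfun_def sgn_cblinfun_def uniformity_cblinfun_def)

end

lift_definition id_cblinfun :: "'a::complex_normed_vector \<Rightarrow>\<^sub>C\<^sub>L 'a" is "\<lambda>x. x"
  by (simp add: clinear_def)

lift_definition cblinfun_compose ::
  "('b::complex_normed_vector \<Rightarrow>\<^sub>C\<^sub>L 'c::complex_normed_vector) \<Rightarrow>
    ('a::complex_normed_vector \<Rightarrow>\<^sub>C\<^sub>L 'b) \<Rightarrow> 'a \<Rightarrow>\<^sub>C\<^sub>L 'c"  (infixl "o\<^sub>C\<^sub>L" 67)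
  is "\<lambda>f g x. f (g x)"
  by (auto simp: clinear_def intro: bounded_linear_compose)

definition op_spectrum :: "('a::complex_normed_vector \<Rightarrow>\<^sub>C\<^sub>L 'a) \<Rightarrow> complex set"
  where "op_spectrum T = {z. \<not> (\<exists>S. S o\<^sub>C\<^sub>L (T - z *\<^sub>C id_cblinfun) = id_cblinfun \<and>
    (T - z *\<^sub>C id_cblinfun) o\<^sub>C\<^sub>L S = id_cblinfun)}"


section \<open>Hilbert space tensor products\<close>

text \<open>
  A Hilbert space tensor product of \<open>'a\<close> and \<open>'b\<close> is a Hilbert space \<open>'k\<close> with a bilinear map
  \<open>t x y\<close> (standing for the elementary tensor of \<open>x\<close> and \<open>y\<close>) under which inner products
  multiply and finite sums of elementary tensors are dense. These properties determine \<open>'k\<close>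
  together with \<open>t\<close> up to a unique unitary compatible with the elementary tensors.
\<close>

definition hilbert_tensor_product ::
    "('a::chilbert_space \<Rightarrow> 'b::chilbert_space \<Rightarrow> 'k::chilbert_space) \<Rightarrow> bool"
  where "hilbert_tensor_product t \<longleftrightarrow>
    (\<forall>y. clinear (\<lambda>x. t x y)) \<and> (\<forall>x. clinear (t x)) \<and>
    (\<forall>x x' y y'. cinner (t x y) (t x' y') = cinner x x' * cinner y y') \<and>
    closure {\<Sum>i<n. t (x i) (y i) | (n::nat) x y. True} = UNIV"

text \<open>
  The tensor product of two bounded operators, as the unique bounded operator acting
  factorwise on elementary tensors.
\<close>

definition op_tensor ::
    "('a::chilbert_space \<Rightarrow> 'b::chilbert_space \<Rightarrow> 'k::chilbert_space) \<Rightarrow>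
      ('a \<Rightarrow>\<^sub>C\<^sub>L 'a) \<Rightarrow> ('b \<Rightarrow>\<^sub>C\<^sub>L 'b) \<Rightarrow> 'k \<Rightarrow>\<^sub>C\<^sub>L 'k"
  where "op_tensor t A B = (THE C. \<forall>x y. cblinfun_apply C (t x y) = t (cblinfun_apply A x) (cblinfun_apply B y))"


section \<open>Operator space structures\<close>

text \<open>
  Matrices over \<open>'w\<close> of size \<open>k\<close> are functions \<open>nat \<Rightarrow> nat \<Rightarrow> 'w\<close> of which only the entries
  with both indices below \<open>k\<close> are used; a system of matrix norms assigns a norm to each
  size and matrix.
\<close>

type_synonym 'w matrix_norms = "nat \<Rightarrow> (nat \<Rightarrow> nat \<Rightarrow> 'w) \<Rightarrow> real"

text \<open>The norm of an operator matrix acting on the \<open>k\<close>-fold Hilbert direct sum of \<open>'k\<close>.\<close>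

definition op_matrix_norm :: "('k::chilbert_space \<Rightarrow>\<^sub>C\<^sub>L 'k) matrix_norms"
  where "op_matrix_norm k A =
    (SUP x \<in> {x :: nat \<Rightarrow> 'k. sqrt (\<Sum>j<k. (norm (x j))\<^sup>2) \<le> 1}.
      sqrt (\<Sum>i<k. (norm (\<Sum>j<k. cblinfun_apply (A i j) (x j)))\<^sup>2))"

text \<open>The norm on \<open>M\<^sub>k\<close>, with scalars acting on the one-dimensional Hilbert space.\<close>

definition scalar_matrix_norm :: "complex matrix_norms"
  where "scalar_matrix_norm k a =
    op_matrix_norm k (\<lambda>i j. a i j *\<^sub>C (id_cblinfun :: complex \<Rightarrow>\<^sub>C\<^sub>L complex))"

definition MIN_norm :: "'w::complex_normed_vector matrix_norms"
  where "MIN_norm k v =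
    (SUP g \<in> {g :: 'w \<Rightarrow>\<^sub>C\<^sub>L complex. norm g \<le> 1}.
      scalar_matrix_norm k (\<lambda>i j. cblinfun_apply g (v i j)))"

definition induced_norm :: "('w \<Rightarrow> 'k::chilbert_space \<Rightarrow>\<^sub>C\<^sub>L 'k) \<Rightarrow> 'w matrix_norms"
  where "induced_norm f k v = op_matrix_norm k (\<lambda>i j. f (v i j))"

definition isometric :: "('w::complex_normed_vector \<Rightarrow> 'v::complex_normed_vector) \<Rightarrow> bool"
  where "isometric f \<longleftrightarrow> (\<forall>w. norm (f w) = norm w)"

definition complete_isometry ::
    "'w::complex_vector matrix_norms \<Rightarrow> 'v::complex_vector matrix_norms \<Rightarrow> ('w \<Rightarrow> 'v) \<Rightarrow> bool"
  where "complete_isometry M N f \<longleftrightarrow>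
    clinear f \<and> (\<forall>k\<ge>1. \<forall>v. N k (\<lambda>i j. f (v i j)) = M k v)"


section \<open>The two-dimensional complex \<open>\<ell>\<^sup>1\<close> space\<close>

datatype ell1_2 = Ell1 (coord1: complex) (coord2: complex)

instantiation ell1_2 :: complex_normed_vector
begin

definition zero_ell1_2 :: ell1_2 where "zero_ell1_2 = Ell1 0 0"

definition plus_ell1_2 :: "ell1_2 \<Rightarrow> ell1_2 \<Rightarrow> ell1_2"
  where "plus_ell1_2 a b = Ell1 (coord1 a + coord1 b) (coord2 a + coord2 b)"

definition minus_ell1_2 :: "ell1_2 \<Rightarrow> ell1_2 \<Rightarrow> ell1_2"
  where "minus_ell1_2 a b = Ell1 (coord1 a - coord1 b) (coord2 a - coord2 b)"

definition uminus_ell1_2 :: "ell1_2 \<Rightarrow> ell1_2"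
  where "uminus_ell1_2 a = Ell1 (- coord1 a) (- coord2 a)"

definition scaleR_ell1_2 :: "real \<Rightarrow> ell1_2 \<Rightarrow> ell1_2"
  where "scaleR_ell1_2 r a = Ell1 (r *\<^sub>R coord1 a) (r *\<^sub>R coord2 a)"

definition scaleC_ell1_2 :: "complex \<Rightarrow> ell1_2 \<Rightarrow> ell1_2"
  where "scaleC_ell1_2 c a = Ell1 (c * coord1 a) (c * coord2 a)"

definition norm_ell1_2 :: "ell1_2 \<Rightarrow> real"
  where "norm_ell1_2 a = cmod (coord1 a) + cmod (coord2 a)"

definition dist_ell1_2 :: "ell1_2 \<Rightarrow> ell1_2 \<Rightarrow> real"
  where "dist_ell1_2 a b = norm (a - b)"

definition sgn_ell1_2 :: "ell1_2 \<Rightarrow> ell1_2"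
  where "sgn_ell1_2 a = inverse (norm a) *\<^sub>R a"

definition uniformity_ell1_2 :: "(ell1_2 \<times> ell1_2) filter"
  where "uniformity_ell1_2 = (INF e\<in>{0 <..}. principal {(x, y). dist x y < e})"

definition open_ell1_2 :: "ell1_2 set \<Rightarrow> bool"
  where "open_ell1_2 S = (\<forall>x\<in>S. \<forall>\<^sub>F (x', y) in uniformity. x' = x \<longrightarrow> y \<in> S)"

instance
proof
  fix x y :: ell1_2
  show "norm (x + y) \<le> norm x + norm y"
    using norm_triangle_ineq[of "coord1 x" "coord1 y"] norm_triangle_ineq[of "coord2 x" "coord2 y"]
    by (simp add: norm_ell1_2_def plus_ell1_2_def)
  show "norm x = 0 \<longleftrightarrow> x = 0"
    by (cases x) (simp add: norm_ell1_2_def zero_ell1_2_def add_nonneg_eq_0_iff)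
qed (auto simp: zero_ell1_2_def plus_ell1_2_def minus_ell1_2_def uminus_ell1_2_def
    scaleR_ell1_2_def scaleC_ell1_2_def norm_ell1_2_def dist_ell1_2_def sgn_ell1_2_def
    uniformity_ell1_2_def open_ell1_2_def algebra_simps scaleR_conv_of_real norm_mult)

end

definition ell1_tensor_map ::
    "('a::chilbert_space \<Rightarrow> 'b::chilbert_space \<Rightarrow> 'k::chilbert_space) \<Rightarrow>
      ('a \<Rightarrow>\<^sub>C\<^sub>L 'a) \<Rightarrow> ('b \<Rightarrow>\<^sub>C\<^sub>L 'b) \<Rightarrow> ell1_2 \<Rightarrow> 'k \<Rightarrow>\<^sub>C\<^sub>L 'k"
  where "ell1_tensor_map t T1 T2 a =
    coord1 a *\<^sub>C op_tensor t T1 id_cblinfun + coord2 a *\<^sub>C op_tensor t id_cblinfun T2"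

end

theory Submission
  imports Defs
begin

text \<open>
  Put \<open>S = T1 \<otimes> I\<close> and \<open>T = I \<otimes> T2\<close>. For a matrix \<open>v\<close> over \<open>\<ell>\<^sup>1(2)\<close> with coordinate matrices
  \<open>a\<close> and \<open>b\<close>, the functionals on \<open>\<ell>\<^sup>1(2)\<close> of norm at most one are the \<open>(l, u)\<close> in the closed
  bidisc, so the MIN norm of \<open>v\<close> is the supremum of the norms of \<open>l a + u b\<close>. Every point of the
  disc is the midpoint of two points of the circle, hence unimodular \<open>l\<close> and \<open>u\<close> suffice. The
  claim is that this supremum is the norm of the operator \<open>a \<otimes> S + b \<otimes> T\<close>.

  The lower bound is where the spectra enter. A point of the circle that lies in the spectrum of a
  contraction is a boundary point of the spectrum and therefore an approximate eigenvalue
  (\<open>contraction_approximate_eigenvector\<close>). Tensoring unit approximate eigenvectors of \<open>T1\<close> for \<open>l\<close>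
  and of \<open>T2\<close> for \<open>u\<close> gives unit vectors \<open>h\<close> on which \<open>S\<close> and \<open>T\<close> act almost as \<open>l\<close> and
  \<open>u\<close>, so \<open>a \<otimes> S + b \<otimes> T\<close> acts on \<open>x \<otimes> h\<close> almost as \<open>l a + u b\<close> acts on \<open>x\<close>
  (\<open>pencil_lower_bound\<close>).

  The upper bound (\<open>pencil_upper_bound\<close>) holds for any two contractions \<open>S\<close> and \<open>T\<close> on a Hilbert
  space. Let \<open>M\<close> bound the squared norms of all \<open>l a + u b\<close> with unimodular \<open>l\<close>,
  \<open>u\<close>. If \<open>S\<close> and \<open>T\<close> were unitary, the tuples \<open>y n = (T S\<^sup>*)\<^sup>n S x\<close> would satisfy
  \<open>\<parallel>a (y n) + b (y (n + 1))\<parallel> = \<parallel>a (S x) + b (T x)\<parallel>\<close> for every \<open>n\<close>, while a discrete Fourier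
  transform of any finite sequence \<open>w\<close>, extended by zero and closed up to a cycle, gives
  \<open>\<Sum> \<parallel>a (w n) + b (w (n + 1))\<parallel>\<^sup>2 \<le> M \<Sum> \<parallel>w n\<parallel>\<^sup>2\<close> (\<open>cyclic_averaging\<close>). Cutting \<open>y\<close> off after
  \<open>N + 1\<close> terms yields \<open>N \<parallel>a (S x) + b (T x)\<parallel>\<^sup>2 \<le> (N + 1) M \<parallel>x\<parallel>\<^sup>2\<close>, and \<open>N\<close> tends to infinity. For
  contractions the sequence \<open>y\<close> lives only in a dilation space, but the argument uses nothing about
  it except inner products. Prescribe them as the Toeplitz kernel of the contraction \<open>T\<^sup>* S\<close>: this
  kernel is positive semidefinite (\<open>psd_on_toeplitz\<close>), and a positive semidefinite kernel on a
  finite set is a sum of rank-one kernels (\<open>psd_on_gram_decomposition\<close>), to each of which the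
  averaging inequality for scalar sequences applies.

  The same rank-one decomposition shows that \<open>T1 \<otimes> I\<close> is a well-defined contraction on finite sums
  of elementary tensors, so that it extends to the Hilbert space tensor product.
\<close>

section \<open>Inner product calculus\<close>

lemma cinner_add_left: "cinner (x + y) (z::'a::complex_inner) = cinner x z + cinner y z"
  by (metis cinner_add_right cinner_commute complex_cnj_add)

lemma cinner_scaleC_left: "cinner (c *\<^sub>C x) (y::'a::complex_inner) = cnj c * cinner x y"
  by (metis cinner_scaleC_right cinner_commute complex_cnj_mult)

lemma cinner_zero_right [simp]: "cinner (x::'a::complex_inner) 0 = 0"
  using cinner_add_right[of x 0 0] by simp

lemma cinner_zero_left [simp]: "cinner 0 (x::'a::complex_inner) = 0"
  using cinner_add_left[of 0 0 x] by simp

lemma cinner_minus_right: "cinner (x::'a::complex_inner) (- y) = - cinner x y"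
  using cinner_add_right[of x y "- y"] by (simp add: eq_neg_iff_add_eq_0 add.commute)

lemma cinner_minus_left: "cinner (- x) (y::'a::complex_inner) = - cinner x y"
  using cinner_add_left[of x "- x" y] by (simp add: eq_neg_iff_add_eq_0 add.commute)

lemma cinner_diff_left: "cinner (x - y) (z::'a::complex_inner) = cinner x z - cinner y z"
  using cinner_add_left[of x "- y" z] by (simp add: cinner_minus_left)

lemma cinner_sum_right: "cinner (x::'a::complex_inner) (\<Sum>i\<in>I. f i) = (\<Sum>i\<in>I. cinner x (f i))"
  by (induction I rule: infinite_finite_induct) (simp_all add: cinner_add_right)

lemma cinner_sum_left: "cinner (\<Sum>i\<in>I. f i) (x::'a::complex_inner) = (\<Sum>i\<in>I. cinner (f i) x)"
  by (induction I rule: infinite_finite_induct) (simp_all add: cinner_add_left)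

lemma cinner_linear_combinations:
  "cinner (\<Sum>i\<in>I. c i *\<^sub>C u i) (\<Sum>j\<in>J. d j *\<^sub>C v j) =
    (\<Sum>i\<in>I. \<Sum>j\<in>J. cnj (c i) * d j * cinner (u i) (v j :: 'a::complex_inner))"
  unfolding cinner_sum_left
  by (simp add: cinner_sum_right sum_distrib_left cinner_scaleC_left cinner_scaleC_right
      mult.left_commute mult.assoc)

lemma norm_power2_cinner: "(norm (x::'a::complex_inner))\<^sup>2 = Re (cinner x x)"
  by (simp add: norm_eq_sqrt_cinner cinner_self_nonneg)

lemma cinner_self: "cinner x x = complex_of_real ((norm (x::'a::complex_inner))\<^sup>2)"
proof -
  have "Im (cinner x x) = 0"
    using arg_cong[OF cinner_commute[of x x], of Im] by simp
  then show ?thesis by (simp add: complex_eq_iff norm_power2_cinner)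
qed

lemma norm_power2_add:
  "(norm (x + y))\<^sup>2 = (norm x)\<^sup>2 + 2 * Re (cinner x y) + (norm (y::'a::complex_inner))\<^sup>2"
proof -
  have "Re (cinner y x) = Re (cinner x y)"
    using cinner_commute[of y x] by simp
  then show ?thesis
    by (simp add: norm_power2_cinner cinner_add_left cinner_add_right)
qed

lemma Cauchy_Schwarz_cinner: "cmod (cinner x y) \<le> norm x * norm (y::'a::complex_inner)"
proof (cases "x = 0")
  case False
  define c where "c = - cinner x y / complex_of_real ((norm x)\<^sup>2)"
  have "0 \<le> (norm (c *\<^sub>C x + y))\<^sup>2" by simp
  also have "\<dots> = (cmod c * norm x)\<^sup>2 + 2 * Re (cnj c * cinner x y) + (norm y)\<^sup>2"
    by (simp add: norm_power2_add norm_scaleC cinner_scaleC_left)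
  also have "cnj c * cinner x y = - complex_of_real ((cmod (cinner x y))\<^sup>2 / (norm x)\<^sup>2)"
    by (simp add: c_def complex_norm_square mult.commute del: of_real_power)
  also have "(cmod c * norm x)\<^sup>2 = (cmod (cinner x y))\<^sup>2 / (norm x)\<^sup>2"
  proof -
    have "cmod (complex_of_real ((norm x)\<^sup>2)) = (norm x)\<^sup>2"
      by (simp only: norm_of_real abs_of_nonneg zero_le_power2)
    then have "cmod c = cmod (cinner x y) / (norm x)\<^sup>2"
      by (simp only: c_def norm_divide norm_minus_cancel)
    then show ?thesis
      using False by (simp add: power2_eq_square)
  qed
  finally have "(cmod (cinner x y))\<^sup>2 / (norm x)\<^sup>2 \<le> (norm y)\<^sup>2" by simp
  then have "(cmod (cinner x y))\<^sup>2 \<le> (norm x * norm y)\<^sup>2"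
    using False by (simp add: divide_le_eq power_mult_distrib mult.commute)
  then show ?thesis
    by (rule power2_le_imp_le) simp
qed simp

lemma cinner_ext_left: "(\<And>x. cinner u x = cinner v x) \<Longrightarrow> u = (v::'a::complex_inner)"
  by (metis cinner_diff_left cinner_self cancel_comm_monoid_add_class.diff_cancel eq_iff_diff_eq_0 norm_eq_zero
      of_real_eq_0_iff power_eq_0_iff)

lemma scaleC_zero_left [simp]: "0 *\<^sub>C x = (0::'a::complex_vector)"
  using scaleC_add_left[of 0 0 x] by simp

lemma scaleC_sum_right: "c *\<^sub>C (\<Sum>i\<in>I. f i) = (\<Sum>i\<in>I. c *\<^sub>C (f i :: 'a::complex_vector))"
  by (induction I rule: infinite_finite_induct) (simp_all add: scaleC_add_right)

lemma scaleC_sum_left: "(\<Sum>i\<in>I. f i) *\<^sub>C x = (\<Sum>i\<in>I. f i *\<^sub>C (x::'a::complex_vector))"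
  by (induction I rule: infinite_finite_induct) (simp_all add: scaleC_add_left)

section \<open>Complex linear maps\<close>

lemma clinear_add: "clinear f \<Longrightarrow> f (x + y) = f x + f y"
  by (simp add: clinear_def)

lemma clinear_scaleC: "clinear f \<Longrightarrow> f (c *\<^sub>C x) = c *\<^sub>C f x"
  by (simp add: clinear_def)

lemma clinear_zero: "clinear f \<Longrightarrow> f 0 = 0"
  using clinear_scaleC[of f 0 0] by simp

lemma clinear_diff: "clinear f \<Longrightarrow> f (x - y) = f x - f y"
  using clinear_add[of f "x - y" y] by simp

lemma clinear_sum: "clinear f \<Longrightarrow> f (\<Sum>i\<in>I. g i) = (\<Sum>i\<in>I. f (g i))"
  by (induction I rule: infinite_finite_induct) (simp_all add: clinear_add clinear_zero)

lemma clinear_funpow: "clinear f \<Longrightarrow> clinear ((f :: 'a::complex_vector \<Rightarrow> 'a) ^^ n)"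
  by (induction n) (simp_all add: clinear_def)

lemma clinear_cblinfun_apply: "clinear (cblinfun_apply T)"
  using cblinfun_apply[of T] by simp

lemma bounded_linear_cblinfun_apply: "bounded_linear (cblinfun_apply T)"
  using cblinfun_apply[of T] by simp

lemma norm_cblinfun_apply: "norm (cblinfun_apply T x) \<le> norm T * norm x"
  using onorm[OF bounded_linear_cblinfun_apply] by (simp add: norm_cblinfun.rep_eq)

lemma contraction_apply: "norm T \<le> 1 \<Longrightarrow> norm (cblinfun_apply T x) \<le> norm x"
  using norm_cblinfun_apply[of T x] mult_right_mono[of "norm T" 1 "norm x"] by simp

lemma bounded_linear_of_clinear:
  assumes "clinear f" "\<And>x. norm (f x) \<le> K * norm x"
  shows "bounded_linear f"
  using assms(2) by (intro bounded_linear_intro[where K = K])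
    (simp_all add: clinear_add[OF assms(1)] clinear_scaleC[OF assms(1)] scaleR_scaleC mult.commute)

lemma Cblinfun_of_clinear:
  assumes "clinear f" "\<And>x. norm (f x) \<le> K * norm x" "0 \<le> K"
  shows "cblinfun_apply (Cblinfun f) = f" and "norm (Cblinfun f) \<le> K"
proof -
  show "cblinfun_apply (Cblinfun f) = f"
    using bounded_linear_of_clinear[OF assms(1,2)] assms(1) by (simp add: Cblinfun_inverse)
  then show "norm (Cblinfun f) \<le> K"
    using assms(2,3) by (auto simp: norm_cblinfun.rep_eq intro: onorm_bound)
qed

lemma cblinfun_eqI: "(\<And>x. cblinfun_apply S x = cblinfun_apply T x) \<Longrightarrow> S = T"
  by (simp add: cblinfun_apply_inject[symmetric] fun_eq_iff)

section \<open>Positive semidefinite matrices\<close>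

definition psd_on :: "'i set \<Rightarrow> ('i \<Rightarrow> 'i \<Rightarrow> complex) \<Rightarrow> bool"
  where "psd_on I G \<longleftrightarrow> (\<forall>i\<in>I. \<forall>j\<in>I. G i j = cnj (G j i)) \<and>
    (\<forall>c. 0 \<le> Re (\<Sum>i\<in>I. \<Sum>j\<in>I. cnj (c i) * c j * G i j))"

text \<open>
  Cholesky factorisation, one index at a time: the row of the new index \<open>p\<close>, divided by the square
  root of its diagonal entry \<open>g\<close>, is the first rank-one term, and the Schur complement of that entry
  is again positive semidefinite. If \<open>g\<close> vanishes, so does the whole row; then the convention
  \<open>z / 0 = 0\<close> makes the formulas below correct in this case too.
\<close>

lemma psd_on_gram_decomposition:
  assumes "finite I" "psd_on I G"
  shows "\<exists>b. \<forall>i\<in>I. \<forall>j\<in>I. G i j = (\<Sum>l\<in>I. cnj (b l i) * b l j)"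
  using assms
proof (induction I arbitrary: G rule: finite_induct)
  case empty
  then show ?case by simp
next
  case (insert p I)
  have herm: "G i j = cnj (G j i)" if "i \<in> insert p I" "j \<in> insert p I" for i j
    using insert.prems[unfolded psd_on_def] that by blast
  have split: "(\<Sum>i\<in>insert p I. \<Sum>j\<in>insert p I. cnj (c i) * c j * G i j) =
      cnj (c p) * c p * G p p + cnj (c p) * (\<Sum>j\<in>I. c j * G p j)
      + c p * cnj (\<Sum>j\<in>I. c j * G p j) + (\<Sum>i\<in>I. \<Sum>j\<in>I. cnj (c i) * c j * G i j)" for c
  proof -
    have "cnj (\<Sum>j\<in>I. c j * G p j) = (\<Sum>j\<in>I. cnj (c j) * G j p)"
      unfolding cnj_sum by (rule sum.cong) (simp_all add: herm[of _ p])
    then show ?thesis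
      using insert.hyps
      by (simp add: sum.distrib sum_distrib_left mult_ac add_ac)
  qed
  have pos: "0 \<le> Re (\<Sum>i\<in>insert p I. \<Sum>j\<in>insert p I. cnj (c i) * c j * G i j)" for c
    using insert.prems[unfolded psd_on_def] by blast
  define g where "g = Re (G p p)"
  have "Im (G p p) = 0"
    using arg_cong[OF herm[of p p], of Im] by simp
  then have gp: "G p p = complex_of_real g"
    by (simp add: g_def complex_eq_iff)
  have g0: "0 \<le> g"
  proof -
    define c where "c = (\<lambda>i. if i = p then 1 else (0::complex))"
    have "(\<Sum>j\<in>I. c j * G p j) = 0" "(\<Sum>i\<in>I. \<Sum>j\<in>I. cnj (c i) * c j * G i j) = 0"
      using insert.hyps by (auto simp: c_def intro!: sum.neutral)
    then show ?thesis
      using pos[of c] unfolding split by (simp add: c_def g_def)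
  qed
  have zero: "G p i = 0" if "g = 0" "i \<in> I" for i
  proof (rule ccontr)
    assume nz: "G p i \<noteq> 0"
    define r where "r = (cmod (G p i))\<^sup>2"
    have r: "r > 0" using nz by (simp add: r_def)
    \<comment> \<open>The form at the vector with \<open>p\<close>-entry \<open>- t * G p i\<close> and \<open>i\<close>-entry \<open>1\<close> is
      \<open>G i i - 2 * t * r\<close>; this \<open>t\<close> is large enough to make it negative.\<close>
    define t where "t = (\<bar>Re (G i i)\<bar> + 1) / r"
    define c where "c = (\<lambda>j. if j = p then - complex_of_real t * G p i else if j = i then 1 else (0::complex))"
    have ip: "i \<noteq> p" using insert.hyps that by blast
    have s1: "(\<Sum>j\<in>I. c j * G p j) = G p i"
    proof -
      have "(\<Sum>j\<in>I. c j * G p j) = (\<Sum>j\<in>I. if j = i then G p i else 0)"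
        using insert.hyps by (intro sum.cong) (auto simp: c_def)
      then show ?thesis using insert.hyps that by simp
    qed
    have s2: "(\<Sum>j\<in>I. \<Sum>k\<in>I. cnj (c j) * c k * G j k) = G i i"
    proof -
      have "(\<Sum>j\<in>I. \<Sum>k\<in>I. cnj (c j) * c k * G j k) = (\<Sum>j\<in>I. \<Sum>k\<in>I. if j = i then (if k = i then G i i else 0) else 0)"
        using insert.hyps by (intro sum.cong) (auto simp: c_def)
      also have "\<dots> = (\<Sum>j\<in>I. if j = i then G i i else 0)"
        using insert.hyps that by (intro sum.cong) auto
      finally show ?thesis using insert.hyps that by simp
    qed
    have cr: "G p i * cnj (G p i) = complex_of_real r"
      by (simp only: r_def complex_norm_square)
    have "0 \<le> Re (cnj (c p) * G p i + c p * cnj (G p i) + G i i)"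
      using pos[of c] unfolding split s1 s2 gp by (simp add: that)
    also have "cnj (c p) * G p i + c p * cnj (G p i) + G i i = complex_of_real (- 2 * t * r) + G i i"
      by (simp add: c_def cr[symmetric] algebra_simps)
    also have "Re \<dots> = - 2 * (\<bar>Re (G i i)\<bar> + 1) + Re (G i i)"
      using r by (simp add: t_def)
    also have "\<dots> < 0" by (simp add: abs_real_def)
    finally show False by simp
  qed
  define G' where "G' = (\<lambda>i j. G i j - cnj (G p i) * G p j / complex_of_real g)"
  have "psd_on I G'"
    unfolding psd_on_def
  proof (intro conjI ballI allI)
    fix i j assume "i \<in> I" "j \<in> I"
    then show "G' i j = cnj (G' j i)"
      using herm[of i j] by (simp add: G'_def mult.commute)
  next
    fix c :: "'a \<Rightarrow> complex"
    define S where "S = (\<Sum>j\<in>I. c j * G p j)"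
    \<comment> \<open>The minimiser of the form over the \<open>p\<close>-entry, all other entries being those of \<open>c\<close>.\<close>
    define d where "d = c(p := - S / complex_of_real g)"
    have S: "(\<Sum>j\<in>I. d j * G p j) = S"
      unfolding S_def d_def using insert.hyps by (intro sum.cong) auto
    have Q: "(\<Sum>i\<in>I. \<Sum>j\<in>I. cnj (d i) * d j * G i j) = (\<Sum>i\<in>I. \<Sum>j\<in>I. cnj (c i) * c j * G i j)"
      unfolding d_def using insert.hyps by (intro sum.cong) auto
    have SS: "(\<Sum>i\<in>I. \<Sum>j\<in>I. cnj (c i) * c j * (cnj (G p i) * G p j / complex_of_real g))
        = cnj S * S / complex_of_real g"
      unfolding S_def cnj_sum sum_product sum_divide_distrib by (simp add: mult_ac)
    have "0 \<le> Re (cnj (d p) * d p * complex_of_real g + cnj (d p) * S + d p * cnj S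
        + (\<Sum>i\<in>I. \<Sum>j\<in>I. cnj (c i) * c j * G i j))"
      using pos[of d] unfolding split S Q gp .
    also have "cnj (d p) * d p * complex_of_real g + cnj (d p) * S + d p * cnj S
        = - (cnj S * S / complex_of_real g)"
      by (cases "g = 0") (simp_all add: d_def field_simps)
    also have "- (cnj S * S / complex_of_real g) + (\<Sum>i\<in>I. \<Sum>j\<in>I. cnj (c i) * c j * G i j)
        = (\<Sum>i\<in>I. \<Sum>j\<in>I. cnj (c i) * c j * G' i j)"
      unfolding G'_def right_diff_distrib sum_subtractf SS by simp
    finally show "0 \<le> Re (\<Sum>i\<in>I. \<Sum>j\<in>I. cnj (c i) * c j * G' i j)" .
  qed
  then obtain b where b: "\<And>i j. i \<in> I \<Longrightarrow> j \<in> I \<Longrightarrow> G' i j = (\<Sum>l\<in>I. cnj (b l i) * b l j)"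
    using insert.IH by blast
  define b' where "b' = (\<lambda>l i. if l = p then G p i / complex_of_real (sqrt g)
    else if i = p then 0 else b l i)"
  have gg: "complex_of_real (sqrt g) * complex_of_real (sqrt g) = complex_of_real g"
    using g0 by (simp flip: of_real_mult)
  have "G i j = (\<Sum>l\<in>insert p I. cnj (b' l i) * b' l j)" if ij: "i \<in> insert p I" "j \<in> insert p I" for i j
  proof -
    have "(\<Sum>l\<in>insert p I. cnj (b' l i) * b' l j)
        = cnj (G p i) * G p j / complex_of_real g + (\<Sum>l\<in>I. cnj (b' l i) * b' l j)"
      using insert.hyps by (simp add: b'_def gg)
    also have "(\<Sum>l\<in>I. cnj (b' l i) * b' l j) = (if i = p \<or> j = p then 0 else G' i j)"
    proof (cases "i = p \<or> j = p")
      case True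
      then show ?thesis using insert.hyps by (auto simp: b'_def intro!: sum.neutral)
    next
      case False
      then have "(\<Sum>l\<in>I. cnj (b' l i) * b' l j) = (\<Sum>l\<in>I. cnj (b l i) * b l j)"
        using insert.hyps by (intro sum.cong) (auto simp: b'_def)
      then show ?thesis using False b[of i j] ij by simp
    qed
    finally show ?thesis
      using zero herm[of i p] ij gp
      by (cases "g = 0") (auto simp: G'_def)
  qed
  then show ?case by blast
qed

text \<open>
  A case of the Schur product theorem, which controls linear combinations of elementary tensors: the
  inner products of elementary tensors are products of Gram matrix entries.
\<close>

lemma psd_on_cinner_sum_nonneg:
  fixes y :: "'i \<Rightarrow> 'a::complex_inner"
  assumes "finite I" "psd_on I G"
  shows "0 \<le> Re (\<Sum>i\<in>I. \<Sum>j\<in>I. G i j * cinner (y i) (y j))"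
proof -
  obtain b where b: "\<And>i j. i \<in> I \<Longrightarrow> j \<in> I \<Longrightarrow> G i j = (\<Sum>l\<in>I. cnj (b l i) * b l j)"
    using psd_on_gram_decomposition[OF assms] by blast
  have "(\<Sum>i\<in>I. \<Sum>j\<in>I. G i j * cinner (y i) (y j))
      = (\<Sum>i\<in>I. \<Sum>j\<in>I. \<Sum>l\<in>I. cinner (b l i *\<^sub>C y i) (b l j *\<^sub>C y j))"
    by (intro sum.cong refl)
      (simp add: b cinner_scaleC_left cinner_scaleC_right sum_distrib_right mult.assoc mult.left_commute)
  also have "\<dots> = (\<Sum>i\<in>I. \<Sum>l\<in>I. \<Sum>j\<in>I. cinner (b l i *\<^sub>C y i) (b l j *\<^sub>C y j))"
    by (intro sum.cong refl sum.swap)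
  also have "\<dots> = (\<Sum>l\<in>I. \<Sum>i\<in>I. \<Sum>j\<in>I. cinner (b l i *\<^sub>C y i) (b l j *\<^sub>C y j))"
    by (rule sum.swap)
  also have "\<dots> = (\<Sum>l\<in>I. cinner (\<Sum>i\<in>I. b l i *\<^sub>C y i) (\<Sum>i\<in>I. b l i *\<^sub>C y i))"
    by (simp add: cinner_sum_left cinner_sum_right) (rule sum.cong[OF refl sum.swap])
  finally show ?thesis
    by (simp add: sum_nonneg cinner_self_nonneg)
qed

section \<open>The Riesz representation\<close>

text \<open>
  The representing vector is the minimiser of \<open>J x = \<parallel>x\<parallel>\<^sup>2 - 2 Re (f x)\<close>. The parallelogram law makes
  minimising sequences Cauchy, and the first variation of \<open>J\<close> at the minimiser \<open>z\<close> says that \<open>f\<close>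
  and \<open>cinner z\<close> have the same real part, hence agree.
\<close>

lemma riesz_representation:
  fixes f :: "'a::chilbert_space \<Rightarrow> complex"
  assumes lin: "clinear f" and bound: "\<And>x. cmod (f x) \<le> K * norm x"
  shows "\<exists>z. \<forall>x. f x = cinner z x"
proof -
  define J where "J = (\<lambda>x. (norm x)\<^sup>2 - 2 * Re (f x))"
  have "J x \<ge> - (K\<^sup>2)" for x
  proof -
    have "Re (f x) \<le> K * norm x"
      using bound[of x] complex_Re_le_cmod[of "f x"] by linarith
    moreover have "0 \<le> (norm x - K)\<^sup>2" by simp
    ultimately show ?thesis by (simp add: J_def power2_diff mult.commute)
  qed
  then have bdd: "bdd_below (range J)" by (intro bdd_belowI2) auto
  define d where "d = Inf (range J)"
  have dJ: "d \<le> J x" for x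
    unfolding d_def using bdd by (intro cInf_lower) auto
  have "\<exists>x. J x < d + 1 / real (Suc n)" for n
  proof -
    have "\<exists>y\<in>range J. y < d + 1 / real (Suc n)"
      using cInf_less_iff[OF _ bdd, of "d + 1 / real (Suc n)"] by (auto simp: d_def)
    then show ?thesis by blast
  qed
  then obtain X where X: "\<And>n. J (X n) < d + 1 / real (Suc n)" by metis
  have par: "(norm (x - y))\<^sup>2 = 2 * J x + 2 * J y - 4 * J ((1/2) *\<^sub>R (x + y))" for x y
  proof -
    have n: "(norm (x - y))\<^sup>2 = 2 * (norm x)\<^sup>2 + 2 * (norm y)\<^sup>2 - (norm (x + y))\<^sup>2"
      using norm_power2_add[of x y] norm_power2_add[of x "- y"]
      by (simp add: cinner_minus_right)
    have fR: "f ((1/2) *\<^sub>R (x + y)) = (f x + f y) / 2"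
      by (simp add: scaleR_scaleC clinear_scaleC[OF lin] clinear_add[OF lin] scaleC_complex_def)
    show ?thesis
      by (simp add: J_def n fR power_divide add_divide_distrib)
  qed
  have "Cauchy X"
  proof (rule CauchyI)
    fix e :: real assume e: "e > 0"
    obtain M where M: "1 / real (Suc M) < e\<^sup>2 / 4"
      using reals_Archimedean[of "e\<^sup>2 / 4"] e by (auto simp: inverse_eq_divide)
    have "norm (X m - X n) < e" if "m \<ge> M" "n \<ge> M" for m n
    proof -
      have s: "1 / real (Suc m) \<le> 1 / real (Suc M)" "1 / real (Suc n) \<le> 1 / real (Suc M)"
        using that by (simp_all add: frac_le)
      have "(norm (X m - X n))\<^sup>2 < e\<^sup>2"
        using par[of "X m" "X n"] X[of m] X[of n] dJ[of "(1/2) *\<^sub>R (X m + X n)"] s M by linarith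
      then show ?thesis by (rule power2_less_imp_less) (use e in simp)
    qed
    then show "\<exists>M. \<forall>m\<ge>M. \<forall>n\<ge>M. norm (X m - X n) < e" by blast
  qed
  then obtain z where z: "X \<longlonglongrightarrow> z"
    using Cauchy_convergent convergent_def by blast
  have bf: "bounded_linear f"
    by (rule bounded_linear_of_clinear[OF lin bound])
  have "(\<lambda>n. J (X n)) \<longlonglongrightarrow> J z"
    unfolding J_def by (intro tendsto_intros z bounded_linear.tendsto[OF bf])
  moreover have "(\<lambda>n. d + 1 / real (Suc n)) \<longlonglongrightarrow> d + 0"
    by (intro tendsto_intros LIMSEQ_Suc[OF lim_1_over_n])
  ultimately have "J z \<le> d + 0"
    by (rule LIMSEQ_le) (use X in \<open>auto intro: less_imp_le\<close>)
  then have min: "J z \<le> J x" for x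
    using dJ[of x] by simp
  have re: "Re (f v) = Re (cinner z v)" for v
  proof (rule ccontr)
    define s where "s = Re (cinner z v) - Re (f v)"
    assume "Re (f v) \<noteq> Re (cinner z v)"
    then have s: "s \<noteq> 0" by (simp add: s_def)
    define q where "q = (norm v)\<^sup>2 + 1"
    have q: "q > 0" by (simp add: q_def add_nonneg_pos)
    define t where "t = - s / q"
    \<comment> \<open>Moving from \<open>z\<close> by the small multiple \<open>t = - s / q\<close> of \<open>v\<close> would decrease \<open>J\<close>.\<close>
    have "0 \<le> J (z + complex_of_real t *\<^sub>C v) - J z"
      using min by simp
    also have "\<dots> = 2 * t * s + t\<^sup>2 * (norm v)\<^sup>2"
      by (simp add: J_def s_def norm_power2_add clinear_add[OF lin] clinear_scaleC[OF lin]
          scaleC_complex_def cinner_scaleC_right norm_scaleC power_mult_distrib algebra_simps)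
    also have "\<dots> \<le> 2 * t * s + t\<^sup>2 * q"
      by (simp add: q_def mult_left_mono)
    also have "\<dots> = - (s\<^sup>2 / q)"
      using q by (simp add: t_def power2_eq_square field_simps)
    finally show False using s q
      by (simp add: divide_le_0_iff)
  qed
  have "f v = cinner z v" for v
  proof -
    have "Re (f (\<i> *\<^sub>C v)) = Re (cinner z (\<i> *\<^sub>C v))" by (rule re)
    then have "Im (f v) = Im (cinner z v)"
      by (simp add: clinear_scaleC[OF lin] scaleC_complex_def cinner_scaleC_right)
    then show ?thesis using re by (simp add: complex_eq_iff)
  qed
  then show ?thesis by blast
qed

section \<open>The Toeplitz kernel of a contraction\<close>

text \<open>
  If \<open>V\<close> is an isometric dilation of the adjoint of \<open>C\<close>, then \<open>toeplitz C m n x y\<close> is the inner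
  product of \<open>V\<^sup>m x\<close> and \<open>V\<^sup>n y\<close>. The kernel stands in for this dilation.
\<close>

definition toeplitz :: "('a::complex_inner \<Rightarrow> 'a) \<Rightarrow> nat \<Rightarrow> nat \<Rightarrow> 'a \<Rightarrow> 'a \<Rightarrow> complex"
  where "toeplitz C m n x y =
    (if n \<le> m then cinner x ((C ^^ (m - n)) y) else cinner ((C ^^ (n - m)) x) y)"

lemma toeplitz_commute: "toeplitz C m n x y = cnj (toeplitz C n m y x)"
  by (cases m n rule: linorder_cases) (simp_all add: toeplitz_def flip: cinner_commute)

lemma toeplitz_sum:
  assumes "clinear C"
  shows "toeplitz C m n (\<Sum>i\<in>I. c i *\<^sub>C x i) (\<Sum>j\<in>J. d j *\<^sub>C y j) =
    (\<Sum>i\<in>I. \<Sum>j\<in>J. cnj (c i) * d j * toeplitz C m n (x i) (y j))"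
  by (simp add: toeplitz_def clinear_sum[OF clinear_funpow[OF assms]]
      clinear_scaleC[OF clinear_funpow[OF assms]] cinner_linear_combinations)

text \<open>
  Positivity of the kernel comes out of an induction that carries a stronger lower bound. With
  \<open>z\<close> for the vector on the left, passing from \<open>N\<close> to \<open>N + 1\<close> replaces \<open>z\<close> by \<open>C z + x (N + 1)\<close>
  and adds \<open>2 Re (cinner (C z) (x (N + 1))) + \<parallel>x (N + 1)\<parallel>\<^sup>2\<close> on the right, which is exactly what is
  needed once \<open>\<parallel>z\<parallel>\<close> has been decreased to \<open>\<parallel>C z\<parallel>\<close>.
\<close>

lemma toeplitz_lower_bound:
  assumes lin: "clinear C" and contr: "\<And>x. norm (C x) \<le> norm x"
  shows "(norm (\<Sum>n\<in>{1..N}. (C ^^ (N - n)) (x n)))\<^sup>2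
    \<le> Re (\<Sum>m\<in>{1..N}. \<Sum>n\<in>{1..N}. toeplitz C m n (x m) (x n))"
proof (induction N)
  case (Suc N)
  define z where "z = (\<Sum>n\<in>{1..N}. (C ^^ (N - n)) (x n))"
  have Cz: "C z = (\<Sum>n\<in>{1..N}. (C ^^ (Suc N - n)) (x n))"
    by (simp add: z_def clinear_sum[OF lin] Suc_diff_le)
  have r: "(\<Sum>n\<in>{1..N}. toeplitz C (Suc N) n (x (Suc N)) (x n)) = cinner (x (Suc N)) (C z)"
    by (simp add: Cz cinner_sum_right toeplitz_def)
  have l: "(\<Sum>n\<in>{1..N}. toeplitz C n (Suc N) (x n) (x (Suc N))) = cinner (C z) (x (Suc N))"
    unfolding Cz cinner_sum_left by (rule sum.cong) (auto simp: toeplitz_def)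
  have "Re (\<Sum>m\<in>{1..Suc N}. \<Sum>n\<in>{1..Suc N}. toeplitz C m n (x m) (x n))
    = Re (\<Sum>m\<in>{1..N}. \<Sum>n\<in>{1..N}. toeplitz C m n (x m) (x n))
      + Re (cinner (C z) (x (Suc N))) + Re (cinner (x (Suc N)) (C z)) + (norm (x (Suc N)))\<^sup>2"
    using l r by (simp add: sum.distrib norm_power2_cinner toeplitz_def[of C "Suc N" "Suc N"])
  also have "Re (cinner (x (Suc N)) (C z)) = Re (cinner (C z) (x (Suc N)))"
    using cinner_commute[of "C z" "x (Suc N)"] by simp
  finally have e: "Re (\<Sum>m\<in>{1..Suc N}. \<Sum>n\<in>{1..Suc N}. toeplitz C m n (x m) (x n))
    = Re (\<Sum>m\<in>{1..N}. \<Sum>n\<in>{1..N}. toeplitz C m n (x m) (x n))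
      + 2 * Re (cinner (C z) (x (Suc N))) + (norm (x (Suc N)))\<^sup>2" by linarith
  have "(\<Sum>n\<in>{1..Suc N}. (C ^^ (Suc N - n)) (x n)) = C z + x (Suc N)"
    by (simp add: Cz)
  moreover have "(norm (C z))\<^sup>2 \<le> Re (\<Sum>m\<in>{1..N}. \<Sum>n\<in>{1..N}. toeplitz C m n (x m) (x n))"
    using Suc.IH[folded z_def] power_mono[OF contr[of z] norm_ge_zero, of 2] by linarith
  ultimately show ?case
    unfolding e by (simp only: norm_power2_add)
qed simp

lemma psd_on_toeplitz:
  fixes C :: "'a::complex_inner \<Rightarrow> 'a" and k :: nat
  assumes lin: "clinear C" and contr: "\<And>x. norm (C x) \<le> norm x"
  shows "psd_on ({1..N} \<times> {..<k}) (\<lambda>p q. toeplitz C (fst p) (fst q) (x (snd p)) (x (snd q)))"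
  unfolding psd_on_def
proof (intro conjI ballI allI)
  fix c :: "nat \<times> nat \<Rightarrow> complex"
  define X where "X = (\<lambda>m. \<Sum>i<k. c (m, i) *\<^sub>C x i)"
  have cart: "(\<Sum>p\<in>{1..N} \<times> {..<k}. F p) = (\<Sum>m\<in>{1..N}. \<Sum>i<k. F (m, i))" for F :: "_ \<Rightarrow> complex"
    by (simp add: sum.cartesian_product split_def)
  have "(\<Sum>p\<in>{1..N} \<times> {..<k}. \<Sum>q\<in>{1..N} \<times> {..<k}.
      cnj (c p) * c q * toeplitz C (fst p) (fst q) (x (snd p)) (x (snd q)))
    = (\<Sum>m\<in>{1..N}. \<Sum>i<k. \<Sum>n\<in>{1..N}. \<Sum>j<k. cnj (c (m, i)) * c (n, j) * toeplitz C m n (x i) (x j))"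
    unfolding cart by simp
  also have "\<dots> = (\<Sum>m\<in>{1..N}. \<Sum>n\<in>{1..N}. \<Sum>i<k. \<Sum>j<k. cnj (c (m, i)) * c (n, j) * toeplitz C m n (x i) (x j))"
    by (intro sum.cong refl sum.swap)
  also have "\<dots> = (\<Sum>m\<in>{1..N}. \<Sum>n\<in>{1..N}. toeplitz C m n (X m) (X n))"
    by (simp add: X_def toeplitz_sum[OF lin])
  also have "0 \<le> Re \<dots>"
    using toeplitz_lower_bound[OF assms, where x = X and N = N]
    by (rule order_trans[rotated]) simp
  finally show "0 \<le> Re (\<Sum>p\<in>{1..N} \<times> {..<k}. \<Sum>q\<in>{1..N} \<times> {..<k}.
      cnj (c p) * c q * toeplitz C (fst p) (fst q) (x (snd p)) (x (snd q)))" .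
qed (rule toeplitz_commute)

section \<open>Averaging over roots of unity\<close>

lemma root_of_unity_orthogonality:
  assumes "m < L" "n < L"
  shows "(\<Sum>s<L. cis (2 * pi * real s * real m / real L) * cnj (cis (2 * pi * real s * real n / real L)))
    = (if m = n then of_nat L else 0)"
proof -
  define w where "w = cis (2 * pi * (real m - real n) / real L)"
  have e: "cis (2 * pi * real s * real m / real L) * cnj (cis (2 * pi * real s * real n / real L)) = w ^ s" for s
    unfolding w_def Complex.DeMoivre cis_cnj cis_mult
    by (rule arg_cong[where f = cis]) (simp add: field_simps diff_divide_distrib)
  show ?thesis
  proof (cases "m = n")
    case True
    then show ?thesis unfolding e by (simp add: w_def)
  next
    case False
    have "w ^ L = cis (2 * pi * real_of_int (int m - int n))"
      unfolding w_def Complex.DeMoivre using assms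
      by (intro arg_cong[where f = cis]) (simp add: field_simps)
    also have "\<dots> = 1" by (rule cis_multiple_2pi) simp
    finally have wL: "w ^ L = 1" .
    have w1: "w \<noteq> 1"
    proof
      assume "w = 1"
      then have "cos (2 * pi * (real m - real n) / real L) = 1"
        by (simp add: w_def complex_eq_iff)
      then obtain q :: int where "2 * pi * (real m - real n) / real L = q * (2 * pi)"
        by (auto simp: cos_one_2pi_int)
      then have "2 * pi * (real m - real n) = 2 * pi * (q * real L)"
        using assms by (simp add: divide_eq_eq)
      then have "real m - real n = q * real L"
        unfolding mult_cancel_left by simp
      then have "real_of_int (int m - int n) = real_of_int (q * int L)"
        by simp
      then have q: "int m - int n = q * int L"
        by (simp only: of_int_eq_iff)
      then have "q \<noteq> 0" using False by auto
      then have "1 * int L \<le> \<bar>q\<bar> * int L"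
        by (intro mult_right_mono) auto
      then have "int L \<le> \<bar>q * int L\<bar>"
        by (simp add: abs_mult)
      then show False using q assms by linarith
    qed
    then show ?thesis
      unfolding e using False by (simp add: geometric_sum wL)
  qed
qed

lemma discrete_Parseval:
  "(\<Sum>s<L. (cmod (\<Sum>m<L. cis (2 * pi * real s * real m / real L) * c m))\<^sup>2) = real L * (\<Sum>m<L. (cmod (c m))\<^sup>2)"
proof -
  define e where "e = (\<lambda>s m. cis (2 * pi * real s * real m / real L))"
  have "complex_of_real (\<Sum>s<L. (cmod (\<Sum>m<L. e s m * c m))\<^sup>2)
    = (\<Sum>s<L. \<Sum>m<L. \<Sum>n<L. (e s m * cnj (e s n)) * (c m * cnj (c n)))"
    unfolding of_real_sum complex_norm_square cnj_sum sum_product by (simp add: mult_ac)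
  also have "\<dots> = (\<Sum>m<L. \<Sum>s<L. \<Sum>n<L. (e s m * cnj (e s n)) * (c m * cnj (c n)))"
    by (rule sum.swap)
  also have "\<dots> = (\<Sum>m<L. \<Sum>n<L. \<Sum>s<L. (e s m * cnj (e s n)) * (c m * cnj (c n)))"
    by (intro sum.cong refl sum.swap)
  also have "\<dots> = (\<Sum>m<L. \<Sum>n<L. if n = m then of_nat L * (c m * cnj (c m)) else 0)"
    unfolding sum_distrib_right[symmetric] e_def
    by (intro sum.cong refl) (simp add: root_of_unity_orthogonality)
  also have "\<dots> = (\<Sum>m<L. of_nat L * (c m * cnj (c m)))"
    by (intro sum.cong refl) simp
  also have "\<dots> = complex_of_real (real L * (\<Sum>m<L. (cmod (c m))\<^sup>2))"
    unfolding of_real_mult of_real_sum complex_norm_square sum_distrib_left by simp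
  finally show ?thesis
    unfolding e_def of_real_eq_iff .
qed

text \<open>
  Under the discrete Fourier transform the cyclic shift \<open>w m \<mapsto> w (Suc m)\<close> becomes multiplication by a
  unimodular scalar, and therefore \<open>a w m + b w (Suc m)\<close> becomes, up to a phase, the image of the
  transform of \<open>w\<close> under a matrix \<open>l a + u b\<close> with unimodular coefficients. Parseval's identity is
  applied on both sides.
\<close>

lemma cyclic_averaging:
  fixes a b :: "nat \<Rightarrow> nat \<Rightarrow> complex"
  assumes bound: "\<And>l u v. cmod l = 1 \<Longrightarrow> cmod u = 1 \<Longrightarrow>
      (\<Sum>i<k. (cmod (\<Sum>j<k. (l * a i j + u * b i j) * v j))\<^sup>2) \<le> M * (\<Sum>j<k. (cmod (v j))\<^sup>2)"
    and cyc: "w L = w 0" and L: "L > 0"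
  shows "(\<Sum>m<L. \<Sum>i<k. (cmod (\<Sum>j<k. a i j * w m j + b i j * w (Suc m) j))\<^sup>2)
    \<le> M * (\<Sum>m<L. \<Sum>j<k. (cmod (w m j))\<^sup>2)"
proof -
  define e where "e = (\<lambda>s m. cis (2 * pi * real s * real m / real L))"
  define v where "v = (\<lambda>s j. \<Sum>m<L. e s m * w m j)"
  have pars: "(\<Sum>s<L. (cmod (\<Sum>m<L. e s m * c m))\<^sup>2) = real L * (\<Sum>m<L. (cmod (c m))\<^sup>2)" for c
    unfolding e_def by (rule discrete_Parseval)
  have eS: "e s (Suc m) = e s 1 * e s m" for s m
    by (simp add: e_def cis_mult field_simps add_divide_distrib)
  have e0: "e s 0 = 1" for s by (simp add: e_def)
  have eL: "e s L = 1" for s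
    using L by (simp add: e_def cis_multiple_2pi)
  have shift: "e s 1 * (\<Sum>m<L. e s m * w (Suc m) j) = v s j" for s j
  proof -
    have "e s 1 * (\<Sum>m<L. e s m * w (Suc m) j) = (\<Sum>m<L. e s (Suc m) * w (Suc m) j)"
      unfolding sum_distrib_left eS by (simp add: mult_ac)
    also have "\<dots> = (\<Sum>m<Suc L. e s m * w m j) - e s 0 * w 0 j"
      by (subst sum.lessThan_Suc_shift) simp
    also have "\<dots> = v s j"
      by (simp add: v_def cyc e0 eL)
    finally show ?thesis .
  qed
  have cm: "cmod (e s 1) = 1" for s by (simp add: e_def)
  have key: "cmod (\<Sum>m<L. e s m * (\<Sum>j<k. a i j * w m j + b i j * w (Suc m) j))
      = cmod (\<Sum>j<k. (e s 1 * a i j + 1 * b i j) * v s j)" for s i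
  proof -
    have "cmod (\<Sum>m<L. e s m * (\<Sum>j<k. a i j * w m j + b i j * w (Suc m) j))
      = cmod (e s 1 * (\<Sum>m<L. e s m * (\<Sum>j<k. a i j * w m j + b i j * w (Suc m) j)))"
      unfolding norm_mult cm by simp
    also have "e s 1 * (\<Sum>m<L. e s m * (\<Sum>j<k. a i j * w m j + b i j * w (Suc m) j))
      = (\<Sum>m<L. \<Sum>j<k. e s 1 * a i j * (e s m * w m j) + b i j * (e s 1 * (e s m * w (Suc m) j)))"
      unfolding sum_distrib_left by (intro sum.cong refl) (simp add: algebra_simps)
    also have "\<dots> = (\<Sum>j<k. \<Sum>m<L. e s 1 * a i j * (e s m * w m j) + b i j * (e s 1 * (e s m * w (Suc m) j)))"
      by (rule sum.swap)
    also have "\<dots> = (\<Sum>j<k. e s 1 * a i j * v s j + b i j * (e s 1 * (\<Sum>m<L. e s m * w (Suc m) j)))"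
      unfolding v_def sum.distrib sum_distrib_left ..
    finally show ?thesis
      unfolding shift by (simp add: distrib_right)
  qed
  have "real L * (\<Sum>m<L. \<Sum>i<k. (cmod (\<Sum>j<k. a i j * w m j + b i j * w (Suc m) j))\<^sup>2)
    = (\<Sum>i<k. real L * (\<Sum>m<L. (cmod (\<Sum>j<k. a i j * w m j + b i j * w (Suc m) j))\<^sup>2))"
    unfolding sum_distrib_left by (rule sum.swap)
  also have "\<dots> = (\<Sum>i<k. \<Sum>s<L. (cmod (\<Sum>j<k. (e s 1 * a i j + 1 * b i j) * v s j))\<^sup>2)"
    unfolding pars[symmetric] key ..
  also have "\<dots> = (\<Sum>s<L. \<Sum>i<k. (cmod (\<Sum>j<k. (e s 1 * a i j + 1 * b i j) * v s j))\<^sup>2)"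
    by (rule sum.swap)
  also have "\<dots> \<le> (\<Sum>s<L. M * (\<Sum>j<k. (cmod (v s j))\<^sup>2))"
    by (intro sum_mono bound cm) simp
  also have "\<dots> = M * (\<Sum>j<k. \<Sum>s<L. (cmod (v s j))\<^sup>2)"
    unfolding sum_distrib_left[symmetric] by (intro arg_cong[where f = "(*) M"] sum.swap)
  also have "\<dots> = M * (\<Sum>j<k. real L * (\<Sum>m<L. (cmod (w m j))\<^sup>2))"
    unfolding v_def pars ..
  also have "\<dots> = real L * (M * (\<Sum>m<L. \<Sum>j<k. (cmod (w m j))\<^sup>2))"
    unfolding sum_distrib_left[symmetric] by (subst sum.swap) simp
  finally show ?thesis using L by simp
qed

section \<open>The upper bound\<close>

text \<open>
  The map \<open>C\<close> is \<open>T\<^sup>* S\<close>.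
\<close>

lemma contraction_mixed_adjoint:
  fixes S T :: "'a::chilbert_space \<Rightarrow>\<^sub>C\<^sub>L 'a"
  assumes "norm S \<le> 1" "norm T \<le> 1"
  obtains C :: "'a \<Rightarrow> 'a"
  where "clinear C" "\<And>x. norm (C x) \<le> norm x"
    "\<And>x y. cinner x (C y) = cinner (cblinfun_apply T x) (cblinfun_apply S y)"
proof -
  have "\<exists>z. \<forall>x. cinner (cblinfun_apply S y) (cblinfun_apply T x) = cinner z x" for y
  proof (rule riesz_representation)
    show "clinear (\<lambda>x. cinner (cblinfun_apply S y) (cblinfun_apply T x))"
      by (simp add: clinear_def clinear_add[OF clinear_cblinfun_apply]
          clinear_scaleC[OF clinear_cblinfun_apply] cinner_add_right cinner_scaleC_right
          scaleC_complex_def)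
    show "cmod (cinner (cblinfun_apply S y) (cblinfun_apply T x)) \<le> norm y * norm x" for x
      using Cauchy_Schwarz_cinner[of "cblinfun_apply S y" "cblinfun_apply T x"]
        mult_mono[OF contraction_apply[OF assms(1), of y] contraction_apply[OF assms(2), of x]]
      by simp
  qed
  then obtain C where C: "\<And>x y. cinner (cblinfun_apply S y) (cblinfun_apply T x) = cinner (C y) x"
    by metis
  have eq: "cinner x (C y) = cinner (cblinfun_apply T x) (cblinfun_apply S y)" for x y
    using C[of y x] by (metis cinner_commute)
  have "clinear C"
    unfolding clinear_def
  proof (intro conjI allI)
    show "C (x + y) = C x + C y" for x y
      by (rule cinner_ext_left)
        (simp add: C[symmetric] cinner_add_left clinear_add[OF clinear_cblinfun_apply])
    show "C (c *\<^sub>C x) = c *\<^sub>C C x" for c x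
      by (rule cinner_ext_left)
        (simp add: C[symmetric] cinner_scaleC_left clinear_scaleC[OF clinear_cblinfun_apply])
  qed
  moreover have "norm (C x) \<le> norm x" for x
  proof (cases "norm (C x) = 0")
    case False
    have "(norm (C x))\<^sup>2 = Re (cinner (cblinfun_apply T (C x)) (cblinfun_apply S x))"
      by (simp only: norm_power2_cinner eq)
    also have "\<dots> \<le> cmod (cinner (cblinfun_apply T (C x)) (cblinfun_apply S x))"
      by (rule complex_Re_le_cmod)
    also have "\<dots> \<le> norm (C x) * norm x"
      using Cauchy_Schwarz_cinner[of "cblinfun_apply T (C x)" "cblinfun_apply S x"]
        mult_mono[OF contraction_apply[OF assms(2), of "C x"] contraction_apply[OF assms(1), of x]]
      by simp
    finally show ?thesis using False by (simp add: power2_eq_square)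
  qed simp
  ultimately show ?thesis using eq by (rule that)
qed

text \<open>
  The kernel of \<open>C = T\<^sup>* S\<close> is the Gram kernel of tuples \<open>y 1, ..., y (N + 1)\<close> such that
  \<open>y m\<close> has the Gram matrix of \<open>x\<close>, and the inner products between \<open>y m\<close> and \<open>y (m + 1)\<close> are those
  between \<open>S x\<close> and \<open>T x\<close>. Thus \<open>\<parallel>(a (y m) + b (y (m + 1)))\<^sub>i\<parallel>\<^sup>2 = E i\<close> for every \<open>m\<close>. The
  number \<open>E i\<close> differs from \<open>\<parallel>(a (S x) + b (T x))\<^sub>i\<parallel>\<^sup>2\<close> only in that the square terms carry
  \<open>X i\<close> and \<open>Y i\<close> in place of their images under \<open>S\<close> and \<open>T\<close>, so it can only be larger.
\<close>

lemma pencil_upper_bound: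
  fixes a b :: "nat \<Rightarrow> nat \<Rightarrow> complex" and S T :: "'k::chilbert_space \<Rightarrow>\<^sub>C\<^sub>L 'k"
  assumes contr: "norm S \<le> 1" "norm T \<le> 1"
    and bound: "\<And>l u v. cmod l = 1 \<Longrightarrow> cmod u = 1 \<Longrightarrow>
      (\<Sum>i<k. (cmod (\<Sum>j<k. (l * a i j + u * b i j) * v j))\<^sup>2) \<le> M * (\<Sum>j<k. (cmod (v j))\<^sup>2)"
  shows "(\<Sum>i<k. (norm (\<Sum>j<k. a i j *\<^sub>C cblinfun_apply S (x j) + b i j *\<^sub>C cblinfun_apply T (x j)))\<^sup>2)
    \<le> M * (\<Sum>j<k. (norm (x j))\<^sup>2)"
proof -
  obtain C where lin: "clinear C" and C: "\<And>x. norm (C x) \<le> norm x"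
    and adj: "\<And>x y. cinner x (C y) = cinner (cblinfun_apply T x) (cblinfun_apply S y)"
    using contraction_mixed_adjoint[OF contr] by blast
  define X where "X = (\<lambda>i. \<Sum>j<k. a i j *\<^sub>C x j)"
  define Y where "Y = (\<lambda>i. \<Sum>j<k. b i j *\<^sub>C x j)"
  define E where "E = (\<lambda>i. (norm (X i))\<^sup>2 + (norm (Y i))\<^sup>2
    + 2 * Re (cinner (cblinfun_apply S (X i)) (cblinfun_apply T (Y i))))"
  define Q where "Q = (\<Sum>j<k. (norm (x j))\<^sup>2)"
  have below: "(norm (\<Sum>j<k. a i j *\<^sub>C cblinfun_apply S (x j) + b i j *\<^sub>C cblinfun_apply T (x j)))\<^sup>2 \<le> E i" for i
  proof -
    have "(\<Sum>j<k. a i j *\<^sub>C cblinfun_apply S (x j) + b i j *\<^sub>C cblinfun_apply T (x j))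
        = cblinfun_apply S (X i) + cblinfun_apply T (Y i)"
      by (simp add: X_def Y_def sum.distrib clinear_sum[OF clinear_cblinfun_apply]
          clinear_scaleC[OF clinear_cblinfun_apply])
    then show ?thesis
      using power_mono[OF contraction_apply[OF contr(1), of "X i"] norm_ge_zero, of 2]
        power_mono[OF contraction_apply[OF contr(2), of "Y i"] norm_ge_zero, of 2]
      by (simp only: E_def norm_power2_add)
  qed
  have main: "real N * (\<Sum>i<k. E i) \<le> real (Suc N) * (M * Q)" for N
  proof -
    define I where "I = {1..Suc N} \<times> {..<k}"
    define G where "G = (\<lambda>p q. toeplitz C (fst p) (fst q) (x (snd p)) (x (snd q)))"
    have fin: "finite I" and psd: "psd_on I G"
      unfolding I_def G_def using psd_on_toeplitz[OF lin C] by auto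
    then obtain g where g: "\<And>p q. p \<in> I \<Longrightarrow> q \<in> I \<Longrightarrow> G p q = (\<Sum>l\<in>I. cnj (g l p) * g l q)"
      using psd_on_gram_decomposition[OF fin psd] by blast
    have gram: "(\<Sum>l\<in>I. cnj (\<Sum>j<k. c j * g l (m, j)) * (\<Sum>j<k. d j * g l (n, j)))
      = toeplitz C m n (\<Sum>j<k. c j *\<^sub>C x j) (\<Sum>j<k. d j *\<^sub>C x j)"
      if "m \<in> {1..Suc N}" "n \<in> {1..Suc N}" for m n c d
    proof -
      have "(\<Sum>l\<in>I. cnj (\<Sum>j<k. c j * g l (m, j)) * (\<Sum>j<k. d j * g l (n, j)))
        = (\<Sum>l\<in>I. \<Sum>i<k. \<Sum>j<k. cnj (c i) * d j * (cnj (g l (m, i)) * g l (n, j)))"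
        unfolding cnj_sum sum_product by (simp add: mult_ac)
      also have "\<dots> = (\<Sum>i<k. \<Sum>l\<in>I. \<Sum>j<k. cnj (c i) * d j * (cnj (g l (m, i)) * g l (n, j)))"
        by (rule sum.swap)
      also have "\<dots> = (\<Sum>i<k. \<Sum>j<k. \<Sum>l\<in>I. cnj (c i) * d j * (cnj (g l (m, i)) * g l (n, j)))"
        by (intro sum.cong refl sum.swap)
      also have "\<dots> = (\<Sum>i<k. \<Sum>j<k. cnj (c i) * d j * G (m, i) (n, j))"
        unfolding sum_distrib_left[symmetric]
        by (intro sum.cong refl) (use that in \<open>simp add: g I_def\<close>)
      finally show ?thesis
        by (simp add: toeplitz_sum[OF lin] G_def)
    qed
    have E: "(\<Sum>l\<in>I. (cmod (\<Sum>j<k. a i j * g l (m, j) + b i j * g l (Suc m, j)))\<^sup>2) = E i"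
      if m: "m \<in> {1..N}" for i m
    proof -
      define u where "u = (\<lambda>l. \<Sum>j<k. a i j * g l (m, j))"
      define w where "w = (\<lambda>l. \<Sum>j<k. b i j * g l (Suc m, j))"
      have mm: "m \<in> {1..Suc N}" "Suc m \<in> {1..Suc N}" using m by auto
      have sq: "(cmod (u l + w l))\<^sup>2 = Re (cnj (u l) * u l + cnj (w l) * w l + cnj (u l) * w l + cnj (w l) * u l)" for l
        using arg_cong[OF complex_norm_square[of "u l + w l"], of Re] by (simp add: algebra_simps)
      have "(\<Sum>l\<in>I. (cmod (u l + w l))\<^sup>2)
        = Re ((\<Sum>l\<in>I. cnj (u l) * u l) + (\<Sum>l\<in>I. cnj (w l) * w l)
            + (\<Sum>l\<in>I. cnj (u l) * w l) + (\<Sum>l\<in>I. cnj (w l) * u l))"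
        unfolding sq sum.distrib[symmetric] Re_sum ..
      also have "\<dots> = Re (cinner (X i) (X i) + cinner (Y i) (Y i) + cinner (C (X i)) (Y i) + cinner (Y i) (C (X i)))"
        unfolding u_def w_def gram[OF mm(1) mm(1)] gram[OF mm(1) mm(2)] gram[OF mm(2) mm(1)] gram[OF mm(2) mm(2)]
        by (simp add: toeplitz_def X_def Y_def)
      also have "Re (cinner (X i) (X i) + cinner (Y i) (Y i) + cinner (C (X i)) (Y i) + cinner (Y i) (C (X i)))
        = (norm (X i))\<^sup>2 + (norm (Y i))\<^sup>2 + 2 * Re (cinner (Y i) (C (X i)))"
        using cinner_commute[of "C (X i)" "Y i"] by (simp add: norm_power2_cinner)
      also have "Re (cinner (Y i) (C (X i))) = Re (cinner (cblinfun_apply S (X i)) (cblinfun_apply T (Y i)))"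
        using cinner_commute[of "cblinfun_apply T (Y i)" "cblinfun_apply S (X i)"] by (simp add: adj)
      finally show ?thesis
        by (simp add: E_def u_def w_def sum.distrib)
    qed
    \<comment> \<open>Only the indices \<open>1, ..., N + 1\<close> carry the kernel. The zeros at \<open>0\<close> and \<open>N + 2\<close> make
      the sequence a cycle of length \<open>N + 2\<close>.\<close>
    define W where "W = (\<lambda>l m j. if m \<in> {1..Suc N} then g l (m, j) else 0)"
    have Wsum: "(\<Sum>m<Suc (Suc N). \<Sum>j<k. (cmod (W l m j))\<^sup>2)
      = (\<Sum>m\<in>{1..Suc N}. \<Sum>j<k. (cmod (g l (m, j)))\<^sup>2)" for l
    proof -
      have "(\<Sum>m<Suc (Suc N). \<Sum>j<k. (cmod (W l m j))\<^sup>2) = (\<Sum>m\<in>{1..Suc N}. \<Sum>j<k. (cmod (W l m j))\<^sup>2)"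
        by (rule sum.mono_neutral_right) (auto simp: W_def)
      then show ?thesis by (simp add: W_def)
    qed
    have "real N * (\<Sum>i<k. E i)
      = (\<Sum>m\<in>{1..N}. \<Sum>i<k. \<Sum>l\<in>I. (cmod (\<Sum>j<k. a i j * g l (m, j) + b i j * g l (Suc m, j)))\<^sup>2)"
      by (simp add: E)
    also have "\<dots> = (\<Sum>m\<in>{1..N}. \<Sum>l\<in>I. \<Sum>i<k. (cmod (\<Sum>j<k. a i j * g l (m, j) + b i j * g l (Suc m, j)))\<^sup>2)"
      by (intro sum.cong refl sum.swap)
    also have "\<dots> = (\<Sum>l\<in>I. \<Sum>m\<in>{1..N}. \<Sum>i<k. (cmod (\<Sum>j<k. a i j * g l (m, j) + b i j * g l (Suc m, j)))\<^sup>2)"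
      by (rule sum.swap)
    also have "\<dots> = (\<Sum>l\<in>I. \<Sum>m\<in>{1..N}. \<Sum>i<k. (cmod (\<Sum>j<k. a i j * W l m j + b i j * W l (Suc m) j))\<^sup>2)"
      by (simp add: W_def)
    also have "\<dots> \<le> (\<Sum>l\<in>I. \<Sum>m<Suc (Suc N). \<Sum>i<k. (cmod (\<Sum>j<k. a i j * W l m j + b i j * W l (Suc m) j))\<^sup>2)"
      by (intro sum_mono sum_mono2) (auto intro: sum_nonneg)
    also have "\<dots> \<le> (\<Sum>l\<in>I. M * (\<Sum>m<Suc (Suc N). \<Sum>j<k. (cmod (W l m j))\<^sup>2))"
      by (intro sum_mono cyclic_averaging bound) (simp_all add: W_def)
    also have "\<dots> = M * (\<Sum>l\<in>I. \<Sum>m\<in>{1..Suc N}. \<Sum>j<k. (cmod (g l (m, j)))\<^sup>2)"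
      unfolding sum_distrib_left[symmetric] Wsum ..
    also have "(\<Sum>l\<in>I. \<Sum>m\<in>{1..Suc N}. \<Sum>j<k. (cmod (g l (m, j)))\<^sup>2)
      = (\<Sum>m\<in>{1..Suc N}. \<Sum>l\<in>I. \<Sum>j<k. (cmod (g l (m, j)))\<^sup>2)"
      by (rule sum.swap)
    also have "\<dots> = (\<Sum>m\<in>{1..Suc N}. \<Sum>j<k. \<Sum>l\<in>I. (cmod (g l (m, j)))\<^sup>2)"
      by (intro sum.cong refl sum.swap)
    also have "\<dots> = (\<Sum>m\<in>{1..Suc N}. \<Sum>j<k. (norm (x j))\<^sup>2)"
    proof (intro sum.cong refl)
      fix m j assume "m \<in> {1..Suc N}" "j \<in> {..<k}"
      then have "(m, j) \<in> I" by (simp add: I_def)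
      then have "Re (G (m, j) (m, j)) = (\<Sum>l\<in>I. Re (cnj (g l (m, j)) * g l (m, j)))"
        by (simp only: g Re_sum)
      also have "\<dots> = (\<Sum>l\<in>I. (cmod (g l (m, j)))\<^sup>2)"
        using complex_norm_square by (metis Re_complex_of_real mult.commute)
      finally show "(\<Sum>l\<in>I. (cmod (g l (m, j)))\<^sup>2) = (norm (x j))\<^sup>2"
        by (simp add: G_def toeplitz_def norm_power2_cinner)
    qed
    also have "M * (\<Sum>m\<in>{1..Suc N}. \<Sum>j<k. (norm (x j))\<^sup>2) = real (Suc N) * (M * Q)"
      by (simp add: Q_def)
    finally show ?thesis .
  qed
  have "(\<Sum>i<k. E i) \<le> M * Q"
  proof (rule LIMSEQ_le_const)
    have "(\<lambda>N. (1 + 1 / real (Suc N)) * (M * Q)) \<longlonglongrightarrow> (1 + 0) * (M * Q)"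
      by (intro tendsto_intros LIMSEQ_Suc[OF lim_1_over_n])
    then show "(\<lambda>N. (1 + 1 / real (Suc N)) * (M * Q)) \<longlonglongrightarrow> M * Q" by simp
    have "(\<Sum>i<k. E i) \<le> (1 + 1 / real (Suc N)) * (M * Q)" for N
    proof -
      have "real (Suc N) * (\<Sum>i<k. E i) \<le> real (Suc N) * ((1 + 1 / real (Suc N)) * (M * Q))"
      proof -
        have "real (Suc N) * (1 + 1 / real (Suc N)) = real (Suc (Suc N))"
          by (simp add: field_simps)
        then show ?thesis
          using main[of "Suc N"] by (simp only: mult.assoc[symmetric])
      qed
      then show ?thesis by (rule mult_left_le_imp_le) simp
    qed
    then show "\<exists>N. \<forall>n\<ge>N. (\<Sum>i<k. E i) \<le> (1 + 1 / real (Suc n)) * (M * Q)" by blast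
  qed
  moreover have "(\<Sum>i<k. (norm (\<Sum>j<k. a i j *\<^sub>C cblinfun_apply S (x j) + b i j *\<^sub>C cblinfun_apply T (x j)))\<^sup>2) \<le> (\<Sum>i<k. E i)"
    by (intro sum_mono below)
  ultimately show ?thesis unfolding Q_def by linarith
qed

section \<open>Approximate eigenvectors\<close>

text \<open>
  The equation is the fixed point equation of \<open>x \<mapsto> (T x - y) / w\<close>, whose Lipschitz constant is
  \<open>1 / \<bar>w\<bar> < 1\<close>.
\<close>

lemma contraction_minus_scalar_surj:
  fixes T :: "'a::chilbert_space \<Rightarrow>\<^sub>C\<^sub>L 'a"
  assumes T: "norm T \<le> 1" and w: "cmod w > 1"
  shows "\<exists>x. cblinfun_apply T x - w *\<^sub>C x = y"
proof -
  define F where "F = (\<lambda>x. inverse w *\<^sub>C (cblinfun_apply T x - y))"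
  have "dist (F x) (F x') \<le> inverse (cmod w) * dist x x'" for x x'
  proof -
    have "F x - F x' = inverse w *\<^sub>C cblinfun_apply T (x - x')"
      by (simp add: F_def clinear_diff[OF clinear_cblinfun_apply] flip: scaleC_diff_right)
    then show ?thesis
      using contraction_apply[OF T, of "x - x'"]
      by (simp add: dist_norm norm_scaleC norm_inverse mult_left_mono)
  qed
  moreover have "inverse (cmod w) < 1"
    using w by (simp add: inverse_less_1_iff)
  ultimately obtain x where x: "F x = x"
    using banach_fix_type[of "inverse (cmod w)" F] by auto
  have "w *\<^sub>C x = w *\<^sub>C F x" by (simp add: x)
  also have "\<dots> = cblinfun_apply T x - y"
  proof -
    have "w \<noteq> 0" using w by auto
    then show ?thesis by (simp add: F_def scaleC_scaleC scaleC_one)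
  qed
  finally show ?thesis by (intro exI[of _ x]) simp
qed

text \<open>
  Otherwise \<open>D = T - z\<close> is bounded below. It is then also surjective: solve \<open>(T - w n) (X n) = y\<close> for
  points \<open>w n\<close> outside the unit disc that tend to \<open>z\<close>; the lower bound for \<open>D\<close> keeps \<open>X n\<close>
  bounded, whence \<open>D (X n)\<close> tends to \<open>y\<close>, and then makes \<open>X\<close> a Cauchy sequence. So \<open>D\<close> is
  invertible, contrary to the choice of \<open>z\<close>.
\<close>

lemma contraction_approximate_eigenvector:
  fixes T :: "'a::chilbert_space \<Rightarrow>\<^sub>C\<^sub>L 'a"
  assumes T: "norm T \<le> 1" and z: "cmod z = 1" and spec: "z \<in> op_spectrum T" and e: "e > 0"
  shows "\<exists>x. norm x = 1 \<and> norm (cblinfun_apply T x - z *\<^sub>C x) < e"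
proof (rule ccontr)
  assume none: "\<not> ?thesis"
  define D where "D = T - z *\<^sub>C id_cblinfun"
  have D: "cblinfun_apply D x = cblinfun_apply T x - z *\<^sub>C x" for x
    by (simp add: D_def minus_cblinfun.rep_eq scaleC_cblinfun.rep_eq id_cblinfun.rep_eq)
  have lin: "clinear (cblinfun_apply D)" by (rule clinear_cblinfun_apply)
  have low: "e * norm x \<le> norm (cblinfun_apply D x)" for x
  proof (cases "x = 0")
    case False
    define u where "u = complex_of_real (inverse (norm x)) *\<^sub>C x"
    have "norm u = 1" using False by (simp add: u_def norm_scaleC norm_inverse)
    then have "e \<le> norm (cblinfun_apply D u)"
      using none D by (metis not_less)
    also have "\<dots> = norm (cblinfun_apply D x) / norm x"
      by (simp add: u_def clinear_scaleC[OF lin] norm_scaleC norm_inverse divide_inverse mult.commute)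
    finally show ?thesis using False by (simp add: field_simps)
  qed simp
  have surj: "\<exists>x. cblinfun_apply D x = y" for y
  proof -
    define w where "w = (\<lambda>n. complex_of_real (1 + 1 / real (Suc n)) * z)"
    have w: "cmod (w n) > 1" "cmod (w n - z) = 1 / real (Suc n)" for n
    proof -
      have "cmod (w n) = \<bar>1 + 1 / real (Suc n)\<bar>"
        unfolding w_def norm_mult z norm_of_real by simp
      then show "cmod (w n) > 1" by simp
      have "w n - z = complex_of_real (1 / real (Suc n)) * z"
        unfolding w_def by (simp add: algebra_simps)
      then have "cmod (w n - z) = \<bar>1 / real (Suc n)\<bar>"
        unfolding norm_mult z by (simp only: norm_mult z norm_of_real)
      then show "cmod (w n - z) = 1 / real (Suc n)" by simp
    qed
    have "\<exists>x. cblinfun_apply T x - w n *\<^sub>C x = y" for n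
      using contraction_minus_scalar_surj[OF T w(1)] .
    then obtain X where X: "\<And>n. cblinfun_apply T (X n) - w n *\<^sub>C X n = y" by metis
    have DX: "cblinfun_apply D (X n) - y = (w n - z) *\<^sub>C X n" for n
    proof -
      have "(w n - z) *\<^sub>C X n + z *\<^sub>C X n = w n *\<^sub>C X n"
        by (simp flip: scaleC_add_left)
      then show ?thesis using X[of n] by (simp add: D algebra_simps)
    qed
    obtain n0 where n0: "1 / real (Suc n0) < e / 2"
      using reals_Archimedean[of "e / 2"] e by (auto simp: inverse_eq_divide)
    have bound: "norm (X n) \<le> 2 * norm y / e" if "n \<ge> n0" for n
    proof -
      have "1 / real (Suc n) \<le> 1 / real (Suc n0)" using that by (simp add: frac_le)
      then have "norm (cblinfun_apply D (X n) - y) \<le> e / 2 * norm (X n)"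
        unfolding DX norm_scaleC w(2) using n0 by (intro mult_right_mono) auto
      then have "e * norm (X n) \<le> norm y + e / 2 * norm (X n)"
        using low[of "X n"] norm_triangle_ineq2[of "cblinfun_apply D (X n)" y] by linarith
      then show ?thesis using e by (simp add: field_simps)
    qed
    have DXlim: "(\<lambda>n. cblinfun_apply D (X n)) \<longlonglongrightarrow> y"
    proof (rule LIM_zero_cancel, rule Lim_null_comparison)
      show "\<forall>\<^sub>F n in sequentially. norm (cblinfun_apply D (X n) - y) \<le> (1 / real (Suc n)) * (2 * norm y / e)"
        using eventually_ge_at_top[of n0]
      proof eventually_elim
        case (elim n)
        then show ?case
          unfolding DX norm_scaleC w(2) by (intro mult_left_mono bound) auto
      qed
      have "(\<lambda>n. (1 / real (Suc n)) * (2 * norm y / e)) \<longlonglongrightarrow> 0 * (2 * norm y / e)"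
        by (intro tendsto_intros LIMSEQ_Suc[OF lim_1_over_n])
      then show "(\<lambda>n. (1 / real (Suc n)) * (2 * norm y / e)) \<longlonglongrightarrow> 0" by simp
    qed
    have "Cauchy X"
    proof (rule CauchyI)
      fix d :: real assume d: "d > 0"
      have "Cauchy (\<lambda>n. cblinfun_apply D (X n))"
        using DXlim by (rule LIMSEQ_imp_Cauchy)
      then obtain M where M: "\<forall>m\<ge>M. \<forall>n\<ge>M. norm (cblinfun_apply D (X m) - cblinfun_apply D (X n)) < e * d"
        using CauchyD[of _ "e * d"] d e by fastforce
      have "norm (X m - X n) < d" if "m \<ge> M" "n \<ge> M" for m n
      proof -
        have "e * norm (X m - X n) < e * d"
          using M that low[of "X m - X n"] by (force simp: clinear_diff[OF lin])
        then show ?thesis using e by simp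
      qed
      then show "\<exists>M. \<forall>m\<ge>M. \<forall>n\<ge>M. norm (X m - X n) < d" by blast
    qed
    then obtain x where "X \<longlonglongrightarrow> x"
      using Cauchy_convergent convergent_def by blast
    then have "(\<lambda>n. cblinfun_apply D (X n)) \<longlonglongrightarrow> cblinfun_apply D x"
      by (rule bounded_linear.tendsto[OF bounded_linear_cblinfun_apply])
    then show ?thesis using DXlim LIMSEQ_unique by blast
  qed
  then obtain R where R: "\<And>y. cblinfun_apply D (R y) = y" by metis
  have inj: "x = x'" if "cblinfun_apply D x = cblinfun_apply D x'" for x x'
    using low[of "x - x'"] that e by (simp add: clinear_diff[OF lin] mult_le_0_iff)
  have "clinear R"
    unfolding clinear_def
  proof (intro conjI allI)
    show "R (x + y) = R x + R y" for x y
      by (rule inj) (simp add: R clinear_add[OF lin])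
    show "R (c *\<^sub>C x) = c *\<^sub>C R x" for c x
      by (rule inj) (simp add: R clinear_scaleC[OF lin])
  qed
  moreover have "norm (R y) \<le> (1 / e) * norm y" for y
    using low[of "R y"] e by (simp add: R field_simps)
  ultimately have app: "cblinfun_apply (Cblinfun R) = R"
    using Cblinfun_of_clinear(1)[of R "1 / e"] e by auto
  have "Cblinfun R o\<^sub>C\<^sub>L D = id_cblinfun" "D o\<^sub>C\<^sub>L Cblinfun R = id_cblinfun"
    by (rule cblinfun_eqI; simp add: cblinfun_compose.rep_eq id_cblinfun.rep_eq app R inj)+
  then show False
    using spec unfolding op_spectrum_def D_def by blast
qed

section \<open>Operators on the Hilbert space tensor product\<close>

lemma hilbert_tensor_product_flip:
  assumes "hilbert_tensor_product t"
  shows "hilbert_tensor_product (\<lambda>y x. t x y)"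
proof -
  have "{\<Sum>i<n. t (x i) (y i) | (n::nat) x y. True} = {\<Sum>i<n. t (x i) (y i) | (n::nat) y x. True}"
    by blast
  then show ?thesis
    using assms unfolding hilbert_tensor_product_def by (simp add: mult.commute)
qed

text \<open>
  The partially defined map is given as a graph \<open>R\<close>, so that its single-valuedness need not be
  known in advance: it follows from the norm estimate, applied to differences. The extension has the
  closure of \<open>R\<close> as its graph.
\<close>

lemma densely_defined_contraction_extends:
  fixes R :: "('a::chilbert_space \<times> 'b::chilbert_space) set"
  assumes add: "\<And>u v u' v'. (u, v) \<in> R \<Longrightarrow> (u', v') \<in> R \<Longrightarrow> (u + u', v + v') \<in> R"
    and scale: "\<And>c u v. (u, v) \<in> R \<Longrightarrow> (c *\<^sub>C u, c *\<^sub>C v) \<in> R"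
    and contr: "\<And>u v. (u, v) \<in> R \<Longrightarrow> norm v \<le> norm u"
    and dense: "closure (fst ` R) = UNIV"
  shows "\<exists>C :: 'a \<Rightarrow>\<^sub>C\<^sub>L 'b. norm C \<le> 1 \<and> (\<forall>(u, v)\<in>R. cblinfun_apply C u = v)"
proof -
  have diff: "(u - u', v - v') \<in> R" if "(u, v) \<in> R" "(u', v') \<in> R" for u v u' v'
  proof -
    have m: "(- 1) *\<^sub>C x = - x" for x :: "'c::complex_vector"
      using scaleR_scaleC[of "- 1" x] by simp
    show ?thesis using add[OF that(1) scale[OF that(2), of "- 1"]] by (simp add: m)
  qed
  define P where "P = (\<lambda>z w. \<exists>u v. (\<forall>n::nat. (u n, v n) \<in> R) \<and> u \<longlonglongrightarrow> z \<and> v \<longlonglongrightarrow> w)"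
  have R_P: "P u v" if "(u, v) \<in> R" for u v
    unfolding P_def using that by (intro exI[of _ "\<lambda>_. u"] exI[of _ "\<lambda>_. v"]) simp
  have P_add: "P (z + z') (w + w')" if p: "P z w" and p': "P z' w'" for z w z' w'
  proof -
    obtain u v where "\<And>n. (u n, v n) \<in> R" "u \<longlonglongrightarrow> z" "v \<longlonglongrightarrow> w"
      using p unfolding P_def by blast
    moreover obtain u' v' where "\<And>n. (u' n, v' n) \<in> R" "u' \<longlonglongrightarrow> z'" "v' \<longlonglongrightarrow> w'"
      using p' unfolding P_def by blast
    ultimately show ?thesis unfolding P_def
      by (intro exI[of _ "\<lambda>n. u n + u' n"] exI[of _ "\<lambda>n. v n + v' n"] conjI allI add tendsto_add)
  qed
  have P_diff: "P (z - z') (w - w')" if p: "P z w" and p': "P z' w'" for z w z' w'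
  proof -
    obtain u v where "\<And>n. (u n, v n) \<in> R" "u \<longlonglongrightarrow> z" "v \<longlonglongrightarrow> w"
      using p unfolding P_def by blast
    moreover obtain u' v' where "\<And>n. (u' n, v' n) \<in> R" "u' \<longlonglongrightarrow> z'" "v' \<longlonglongrightarrow> w'"
      using p' unfolding P_def by blast
    ultimately show ?thesis unfolding P_def
      by (intro exI[of _ "\<lambda>n. u n - u' n"] exI[of _ "\<lambda>n. v n - v' n"] conjI allI diff tendsto_diff)
  qed
  have P_scale: "P (c *\<^sub>C z) (c *\<^sub>C w)" if p: "P z w" for c z w
  proof -
    obtain u v where "\<And>n. (u n, v n) \<in> R" "u \<longlonglongrightarrow> z" "v \<longlonglongrightarrow> w"
      using p unfolding P_def by blast
    then show ?thesis unfolding P_def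
      by (intro exI[of _ "\<lambda>n. c *\<^sub>C u n"] exI[of _ "\<lambda>n. c *\<^sub>C v n"] conjI allI scale
          bounded_linear.tendsto[OF bounded_linear_scaleC])
  qed
  have P_norm: "norm w \<le> norm z" if Pzw: "P z w" for z w
  proof -
    obtain u v where "\<And>n. (u n, v n) \<in> R" "u \<longlonglongrightarrow> z" "v \<longlonglongrightarrow> w"
      using Pzw unfolding P_def by blast
    then show ?thesis
      by (intro LIMSEQ_le[OF tendsto_norm[of v w] tendsto_norm[of u z]]) (auto intro: contr)
  qed
  have P_total: "\<exists>w. P z w" for z
  proof -
    have "z \<in> closure (fst ` R)" using dense by simp
    then obtain u where u: "\<And>n. u n \<in> fst ` R" "u \<longlonglongrightarrow> z"
      unfolding closure_sequential by blast
    then have "\<exists>v. (u n, v) \<in> R" for n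
      using u(1)[of n] by force
    then obtain v where v: "\<And>n. (u n, v n) \<in> R" by metis
    have "Cauchy v"
    proof (rule CauchyI)
      fix e :: real assume e: "e > 0"
      obtain M where M: "\<forall>m\<ge>M. \<forall>n\<ge>M. norm (u m - u n) < e"
        using CauchyD[OF LIMSEQ_imp_Cauchy[OF u(2)] e] by blast
      have "norm (v m - v n) < e" if "m \<ge> M" "n \<ge> M" for m n
        using M that contr[OF diff[OF v[of m] v[of n]]] by (meson le_less_trans)
      then show "\<exists>M. \<forall>m\<ge>M. \<forall>n\<ge>M. norm (v m - v n) < e" by blast
    qed
    then obtain w where "v \<longlonglongrightarrow> w"
      using Cauchy_convergent convergent_def by blast
    then show ?thesis
      using u v unfolding P_def by blast
  qed
  have P_unique: "w = w'" if "P z w" "P z w'" for z w w'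
    using P_norm[OF P_diff[OF that]] by simp
  obtain F where F: "\<And>z. P z (F z)" using P_total by metis
  have Flin: "clinear F"
    unfolding clinear_def
    by (intro conjI allI P_unique[OF F] P_add[OF F F] P_scale[OF F])
  have Fnorm: "norm (F z) \<le> 1 * norm z" for z
    using P_norm[OF F] by simp
  have "cblinfun_apply (Cblinfun F) = F" "norm (Cblinfun F) \<le> 1"
    using Cblinfun_of_clinear[OF Flin Fnorm] by simp_all
  moreover have "F u = v" if "(u, v) \<in> R" for u v
    using P_unique[OF F R_P[OF that]] .
  ultimately show ?thesis by (intro exI[of _ "Cblinfun F"]) auto
qed

lemma sum_append:
  fixes n m :: nat and f g :: "nat \<Rightarrow> 'a::comm_monoid_add"
  shows "(\<Sum>i<n + m. if i < n then f i else g (i - n)) = (\<Sum>i<n. f i) + (\<Sum>i<m. g i)"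
  by (induction m) (simp_all add: add.assoc)

lemma psd_on_contraction_defect:
  fixes A :: "'a::complex_inner \<Rightarrow>\<^sub>C\<^sub>L 'b::complex_inner"
  assumes "norm A \<le> 1"
  shows "psd_on I (\<lambda>i j. cinner (x i) (x j) - cinner (cblinfun_apply A (x i)) (cblinfun_apply A (x j)))"
  unfolding psd_on_def
proof (intro conjI ballI allI)
  fix c :: "'c \<Rightarrow> complex"
  define z where "z = (\<Sum>i\<in>I. c i *\<^sub>C x i)"
  have Az: "cblinfun_apply A z = (\<Sum>i\<in>I. c i *\<^sub>C cblinfun_apply A (x i))"
    by (simp add: z_def clinear_sum[OF clinear_cblinfun_apply] clinear_scaleC[OF clinear_cblinfun_apply])
  have "(\<Sum>i\<in>I. \<Sum>j\<in>I. cnj (c i) * c j * (cinner (x i) (x j) - cinner (cblinfun_apply A (x i)) (cblinfun_apply A (x j))))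
    = cinner z z - cinner (cblinfun_apply A z) (cblinfun_apply A z)"
    unfolding right_diff_distrib sum_subtractf Az unfolding z_def cinner_linear_combinations ..
  then show "0 \<le> Re (\<Sum>i\<in>I. \<Sum>j\<in>I. cnj (c i) * c j * (cinner (x i) (x j) - cinner (cblinfun_apply A (x i)) (cblinfun_apply A (x j))))"
    using power_mono[OF contraction_apply[OF assms, of z] norm_ge_zero, of 2]
    by (simp add: norm_power2_cinner)
qed (simp flip: cinner_commute)

text \<open>
  For \<open>u = \<Sum> t (x i) (y i)\<close> and its intended image \<open>v\<close>, the difference \<open>\<parallel>u\<parallel>\<^sup>2 - \<parallel>v\<parallel>\<^sup>2\<close> pairs the Gram
  matrix of \<open>y\<close> with the difference of the Gram matrices of \<open>x\<close> and of its image under \<open>A\<close>. Both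
  are positive semidefinite, so the difference is nonnegative.
\<close>

lemma tensor_contraction_exists:
  fixes t :: "'a::chilbert_space \<Rightarrow> 'b::chilbert_space \<Rightarrow> 'k::chilbert_space"
  assumes t: "hilbert_tensor_product t" and A: "norm A \<le> 1"
  shows "\<exists>C. norm C \<le> 1 \<and> (\<forall>x y. cblinfun_apply C (t x y) = t (cblinfun_apply A x) y)"
proof -
  have lin: "clinear (\<lambda>x. t x y)" for y
    using t unfolding hilbert_tensor_product_def by blast
  have inner: "cinner (t x y) (t x' y') = cinner x x' * cinner y y'" for x x' y y'
    using t unfolding hilbert_tensor_product_def by blast
  define R where "R = {(\<Sum>i<n. t (x i) (y i), \<Sum>i<n. t (cblinfun_apply A (x i)) (y i)) | (n::nat) x y. True}"
  have R_I: "(\<Sum>i<n. t (x i) (y i), \<Sum>i<n. t (cblinfun_apply A (x i)) (y i)) \<in> R" for x y and n :: nat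
    unfolding R_def by (rule CollectI, rule exI[of _ n], rule exI[of _ x], rule exI[of _ y]) simp
  have "\<exists>C :: 'k \<Rightarrow>\<^sub>C\<^sub>L 'k. norm C \<le> 1 \<and> (\<forall>(u, v)\<in>R. cblinfun_apply C u = v)"
  proof (rule densely_defined_contraction_extends)
    fix u v u' v' assume "(u, v) \<in> R" "(u', v') \<in> R"
    then obtain n x y m x' y' where
      e: "u = (\<Sum>i<(n::nat). t (x i) (y i))" "v = (\<Sum>i<n. t (cblinfun_apply A (x i)) (y i))"
      "u' = (\<Sum>i<(m::nat). t (x' i) (y' i))" "v' = (\<Sum>i<m. t (cblinfun_apply A (x' i)) (y' i))"
      unfolding R_def by blast
    define x'' where "x'' = (\<lambda>i. if i < n then x i else x' (i - n))"
    define y'' where "y'' = (\<lambda>i. if i < n then y i else y' (i - n))"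
    have "u + u' = (\<Sum>i<n + m. t (x'' i) (y'' i))" "v + v' = (\<Sum>i<n + m. t (cblinfun_apply A (x'' i)) (y'' i))"
      unfolding e sum_append[symmetric] x''_def y''_def by (auto intro!: sum.cong)
    then show "(u + u', v + v') \<in> R"
      using R_I[of x'' y'' "n + m"] by simp
  next
    fix c u v assume "(u, v) \<in> R"
    then obtain n x y where
      e: "u = (\<Sum>i<(n::nat). t (x i) (y i))" "v = (\<Sum>i<n. t (cblinfun_apply A (x i)) (y i))"
      unfolding R_def by blast
    have "c *\<^sub>C u = (\<Sum>i<n. t (c *\<^sub>C x i) (y i))" "c *\<^sub>C v = (\<Sum>i<n. t (cblinfun_apply A (c *\<^sub>C x i)) (y i))"
      unfolding e by (simp_all add: scaleC_sum_right clinear_scaleC[OF lin] clinear_scaleC[OF clinear_cblinfun_apply])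
    then show "(c *\<^sub>C u, c *\<^sub>C v) \<in> R"
      using R_I[of "\<lambda>i. c *\<^sub>C x i" y n] by simp
  next
    fix u v assume "(u, v) \<in> R"
    then obtain n x y where
      e: "u = (\<Sum>i<(n::nat). t (x i) (y i))" "v = (\<Sum>i<n. t (cblinfun_apply A (x i)) (y i))"
      unfolding R_def by blast
    have sq: "cinner (\<Sum>i<n. t (x i) (y i)) (\<Sum>i<n. t (x i) (y i)) = (\<Sum>i<n. \<Sum>j<n. cinner (x i) (x j) * cinner (y i) (y j))" for x
      unfolding cinner_sum_left by (simp only: cinner_sum_right inner)
    have "(norm u)\<^sup>2 - (norm v)\<^sup>2 = Re (\<Sum>i<n. \<Sum>j<n.
        (cinner (x i) (x j) - cinner (cblinfun_apply A (x i)) (cblinfun_apply A (x j))) * cinner (y i) (y j))"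
      unfolding norm_power2_cinner e sq left_diff_distrib sum_subtractf by simp
    also have "0 \<le> \<dots>"
      by (rule psd_on_cinner_sum_nonneg[OF _ psd_on_contraction_defect[OF A]]) simp
    finally have "(norm v)\<^sup>2 \<le> (norm u)\<^sup>2" by simp
    then show "norm v \<le> norm u" by (rule power2_le_imp_le) simp
  next
    have "{\<Sum>i<n. t (x i) (y i) | (n::nat) x y. True} \<subseteq> fst ` R"
      using R_I by (force simp: image_iff)
    then have "closure {\<Sum>i<n. t (x i) (y i) | (n::nat) x y. True} \<subseteq> closure (fst ` R)"
      by (rule closure_mono)
    then show "closure (fst ` R) = UNIV"
      using t unfolding hilbert_tensor_product_def by blast
  qed
  moreover have "(t x y, t (cblinfun_apply A x) y) \<in> R" for x y
    using R_I[of "\<lambda>_. x" "\<lambda>_. y" 1] by simp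
  ultimately show ?thesis by fast
qed

text \<open>
  A bounded operator is determined by its values on elementary tensors, because their finite sums are
  dense.
\<close>

lemma op_tensor_eqI:
  fixes t :: "'a::chilbert_space \<Rightarrow> 'b::chilbert_space \<Rightarrow> 'k::chilbert_space"
  assumes t: "hilbert_tensor_product t"
    and C: "\<And>x y. cblinfun_apply C (t x y) = t (cblinfun_apply A x) (cblinfun_apply B y)"
  shows "op_tensor t A B = C"
  unfolding op_tensor_def
proof (rule the_equality)
  fix C' assume C': "\<forall>x y. cblinfun_apply C' (t x y) = t (cblinfun_apply A x) (cblinfun_apply B y)"
  have "closed {z. cblinfun_apply C' z = cblinfun_apply C z}"
    by (intro closed_Collect_eq linear_continuous_on bounded_linear_cblinfun_apply)
  moreover have "{\<Sum>i<n. t (x i) (y i) | (n::nat) x y. True} \<subseteq> {z. cblinfun_apply C' z = cblinfun_apply C z}"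
    using C C' by (auto simp: clinear_sum[OF clinear_cblinfun_apply])
  ultimately have "closure {\<Sum>i<n. t (x i) (y i) | (n::nat) x y. True} \<subseteq> {z. cblinfun_apply C' z = cblinfun_apply C z}"
    by (rule closure_minimal[rotated])
  then have "{z. cblinfun_apply C' z = cblinfun_apply C z} = UNIV"
    using t unfolding hilbert_tensor_product_def by blast
  then show "C' = C" by (intro cblinfun_eqI) blast
qed (use C in blast)

lemma op_tensor_contraction_left:
  assumes t: "hilbert_tensor_product t" and A: "norm A \<le> 1"
  shows "norm (op_tensor t A id_cblinfun) \<le> 1"
    and "cblinfun_apply (op_tensor t A id_cblinfun) (t x y) = t (cblinfun_apply A x) y"
proof -
  obtain C where "norm C \<le> 1" "\<And>x y. cblinfun_apply C (t x y) = t (cblinfun_apply A x) y"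
    using tensor_contraction_exists[OF assms] by blast
  moreover from this(2) have "op_tensor t A id_cblinfun = C"
    by (intro op_tensor_eqI[OF t]) (simp add: id_cblinfun.rep_eq)
  ultimately show "norm (op_tensor t A id_cblinfun) \<le> 1"
    "cblinfun_apply (op_tensor t A id_cblinfun) (t x y) = t (cblinfun_apply A x) y"
    by simp_all
qed

lemma op_tensor_contraction_right:
  assumes t: "hilbert_tensor_product t" and B: "norm B \<le> 1"
  shows "norm (op_tensor t id_cblinfun B) \<le> 1"
    and "cblinfun_apply (op_tensor t id_cblinfun B) (t x y) = t x (cblinfun_apply B y)"
proof -
  obtain C where "norm C \<le> 1" "\<And>x y. cblinfun_apply C (t x y) = t x (cblinfun_apply B y)"
    using tensor_contraction_exists[OF hilbert_tensor_product_flip[OF t] B] by blast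
  moreover from this(2) have "op_tensor t id_cblinfun B = C"
    by (intro op_tensor_eqI[OF t]) (simp add: id_cblinfun.rep_eq)
  ultimately show "norm (op_tensor t id_cblinfun B) \<le> 1"
    "cblinfun_apply (op_tensor t id_cblinfun B) (t x y) = t x (cblinfun_apply B y)"
    by simp_all
qed

lemma norm_tensor:
  assumes "hilbert_tensor_product t"
  shows "norm (t x y) = norm x * norm y"
proof -
  have "cinner (t x y) (t x y) = cinner x x * cinner y y"
    using assms unfolding hilbert_tensor_product_def by blast
  then have "(norm (t x y))\<^sup>2 = Re (cinner x x * cinner y y)"
    by (simp only: norm_power2_cinner)
  also have "\<dots> = (norm x * norm y)\<^sup>2"
    by (simp add: cinner_self power_mult_distrib)
  finally have "(norm (t x y))\<^sup>2 = (norm x * norm y)\<^sup>2" .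
  then show ?thesis by (rule power2_eq_imp_eq) simp_all
qed

definition joint_approximate_eigenvalue ::
    "('k::complex_normed_vector \<Rightarrow>\<^sub>C\<^sub>L 'k) \<Rightarrow> ('k \<Rightarrow>\<^sub>C\<^sub>L 'k) \<Rightarrow> complex \<Rightarrow> complex \<Rightarrow> bool"
  where "joint_approximate_eigenvalue S T l u \<longleftrightarrow> (\<exists>h :: nat \<Rightarrow> 'k.
    (\<forall>n. norm (h n) = 1) \<and> (\<lambda>n. cblinfun_apply S (h n) - l *\<^sub>C h n) \<longlonglongrightarrow> 0 \<and>
    (\<lambda>n. cblinfun_apply T (h n) - u *\<^sub>C h n) \<longlonglongrightarrow> 0)"

lemma tensor_joint_approximate_eigenvalue:
  fixes t :: "'a::chilbert_space \<Rightarrow> 'b::chilbert_space \<Rightarrow> 'k::chilbert_space"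
  assumes t: "hilbert_tensor_product t" and T: "norm T1 \<le> 1" "norm T2 \<le> 1"
    and spec: "sphere 0 1 \<subseteq> op_spectrum T1" "sphere 0 1 \<subseteq> op_spectrum T2"
    and l: "cmod l = 1" and u: "cmod u = 1"
  shows "joint_approximate_eigenvalue (op_tensor t T1 id_cblinfun) (op_tensor t id_cblinfun T2) l u"
proof -
  have lin1: "clinear (\<lambda>x. t x y)" for y
    using t unfolding hilbert_tensor_product_def by blast
  have lin2: "clinear (t x)" for x
    using t unfolding hilbert_tensor_product_def by blast
  have "\<exists>x. norm x = 1 \<and> norm (cblinfun_apply T1 x - l *\<^sub>C x) < 1 / real (Suc n)" for n
    by (rule contraction_approximate_eigenvector[OF T(1) l]) (use spec(1) l in auto)
  then obtain x where x: "\<And>n. norm (x n) = 1"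
    "\<And>n. norm (cblinfun_apply T1 (x n) - l *\<^sub>C x n) < 1 / real (Suc n)" by metis
  have "\<exists>y. norm y = 1 \<and> norm (cblinfun_apply T2 y - u *\<^sub>C y) < 1 / real (Suc n)" for n
    by (rule contraction_approximate_eigenvector[OF T(2) u]) (use spec(2) u in auto)
  then obtain y where y: "\<And>n. norm (y n) = 1"
    "\<And>n. norm (cblinfun_apply T2 (y n) - u *\<^sub>C y n) < 1 / real (Suc n)" by metis
  define h where "h = (\<lambda>n. t (x n) (y n))"
  have h1: "cblinfun_apply (op_tensor t T1 id_cblinfun) (h n) - l *\<^sub>C h n
      = t (cblinfun_apply T1 (x n) - l *\<^sub>C x n) (y n)" for n
    by (simp add: h_def op_tensor_contraction_left(2)[OF t T(1)] clinear_diff[OF lin1] clinear_scaleC[OF lin1])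
  have h2: "cblinfun_apply (op_tensor t id_cblinfun T2) (h n) - u *\<^sub>C h n
      = t (x n) (cblinfun_apply T2 (y n) - u *\<^sub>C y n)" for n
    by (simp add: h_def op_tensor_contraction_right(2)[OF t T(2)] clinear_diff[OF lin2] clinear_scaleC[OF lin2])
  have null: "v \<longlonglongrightarrow> 0" if "\<And>n. norm (v n) \<le> 1 / real (Suc n)" for v :: "nat \<Rightarrow> 'k"
    by (rule Lim_null_comparison[OF _ LIMSEQ_Suc[OF lim_1_over_n]]) (use that in auto)
  show ?thesis
    unfolding joint_approximate_eigenvalue_def
  proof (intro exI[of _ h] conjI allI null)
    show "norm (h n) = 1" for n
      by (simp add: h_def norm_tensor[OF t] x y)
    show "norm (cblinfun_apply (op_tensor t T1 id_cblinfun) (h n) - l *\<^sub>C h n) \<le> 1 / real (Suc n)" for n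
      unfolding h1 norm_tensor[OF t] y(1) using x(2)[of n] by simp
    show "norm (cblinfun_apply (op_tensor t id_cblinfun T2) (h n) - u *\<^sub>C h n) \<le> 1 / real (Suc n)" for n
      unfolding h2 norm_tensor[OF t] x(1) using y(2)[of n] by simp
  qed
qed

section \<open>Matrix norms\<close>

text \<open>
  A crude bound, whose purpose is to make the suprema in the matrix norms finite.
\<close>

lemma op_matrix_norm_sum_bound:
  fixes k :: nat
  assumes "sqrt (\<Sum>j<k. (norm (x j))\<^sup>2) \<le> 1"
  shows "sqrt (\<Sum>i<k. (norm (\<Sum>j<k. cblinfun_apply (A i j) (x j)))\<^sup>2) \<le> (\<Sum>i<k. \<Sum>j<k. norm (A i j))"
proof -
  have x1: "norm (x j) \<le> 1" if "j < k" for j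
  proof -
    have "(norm (x j))\<^sup>2 \<le> (\<Sum>j<k. (norm (x j))\<^sup>2)"
      using that by (intro member_le_sum) auto
    also have "\<dots> \<le> 1" using assms by simp
    finally show ?thesis by (simp add: power_le_one_iff abs_square_le_1)
  qed
  have "sqrt (\<Sum>i<k. (norm (\<Sum>j<k. cblinfun_apply (A i j) (x j)))\<^sup>2)
      \<le> (\<Sum>i<k. norm (\<Sum>j<k. cblinfun_apply (A i j) (x j)))"
    using L2_set_le_sum[of "{..<k}" "\<lambda>i. norm (\<Sum>j<k. cblinfun_apply (A i j) (x j))"]
    by (simp add: L2_set_def)
  also have "\<dots> \<le> (\<Sum>i<k. \<Sum>j<k. norm (A i j))"
  proof (intro sum_mono order_trans[OF norm_sum])
    fix i j assume "j \<in> {..<k}"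
    then show "norm (cblinfun_apply (A i j) (x j)) \<le> norm (A i j)"
      using norm_cblinfun_apply[of "A i j" "x j"] mult_left_mono[OF x1[of j], of "norm (A i j)"] by simp
  qed
  finally show ?thesis .
qed

lemma op_matrix_norm_upper:
  fixes x :: "nat \<Rightarrow> 'k::chilbert_space"
  assumes "sqrt (\<Sum>j<k. (norm (x j))\<^sup>2) \<le> 1"
  shows "sqrt (\<Sum>i<k. (norm (\<Sum>j<k. cblinfun_apply (A i j) (x j)))\<^sup>2) \<le> op_matrix_norm k A"
  unfolding op_matrix_norm_def
proof (rule cSUP_upper)
  show "bdd_above ((\<lambda>x :: nat \<Rightarrow> 'k. sqrt (\<Sum>i<k. (norm (\<Sum>j<k. cblinfun_apply (A i j) (x j)))\<^sup>2))
      ` {x. sqrt (\<Sum>j<k. (norm (x j))\<^sup>2) \<le> 1})"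
    by (rule bdd_aboveI2[where M = "\<Sum>i<k. \<Sum>j<k. norm (A i j)"]) (simp add: op_matrix_norm_sum_bound)
qed (use assms in simp)

lemma op_matrix_norm_least:
  fixes A :: "nat \<Rightarrow> nat \<Rightarrow> 'k::chilbert_space \<Rightarrow>\<^sub>C\<^sub>L 'k"
  assumes "\<And>x. sqrt (\<Sum>j<k. (norm (x j))\<^sup>2) \<le> 1 \<Longrightarrow>
    sqrt (\<Sum>i<k. (norm (\<Sum>j<k. cblinfun_apply (A i j) (x j)))\<^sup>2) \<le> B"
  shows "op_matrix_norm k A \<le> B"
  unfolding op_matrix_norm_def
proof (rule cSUP_least)
  show "{x :: nat \<Rightarrow> 'k. sqrt (\<Sum>j<k. (norm (x j))\<^sup>2) \<le> 1} \<noteq> {}"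
    by (auto intro!: exI[of _ "\<lambda>_. 0"])
qed (use assms in simp)

lemma op_matrix_norm_nonneg: "0 \<le> op_matrix_norm k (A :: nat \<Rightarrow> nat \<Rightarrow> 'k::chilbert_space \<Rightarrow>\<^sub>C\<^sub>L 'k)"
  by (rule order_trans[OF _ op_matrix_norm_upper[where x = "\<lambda>_. 0"]]) (auto intro: sum_nonneg)

lemma op_matrix_norm_bound:
  "(\<Sum>i<k. (norm (\<Sum>j<k. cblinfun_apply (A i j) (x j)))\<^sup>2) \<le> (op_matrix_norm k A)\<^sup>2 * (\<Sum>j<k. (norm (x j))\<^sup>2)"
proof -
  define s where "s = sqrt (\<Sum>j<k. (norm (x j))\<^sup>2)"
  have s2: "s\<^sup>2 = (\<Sum>j<k. (norm (x j))\<^sup>2)" and s0: "0 \<le> s"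
    by (simp_all add: s_def sum_nonneg)
  show ?thesis
  proof (cases "s = 0")
    case True
    then have "\<forall>j\<in>{..<k}. (norm (x j))\<^sup>2 = 0"
      using s2 sum_nonneg_eq_0_iff[of "{..<k}" "\<lambda>j. (norm (x j))\<^sup>2"] by simp
    then have "x j = 0" if "j < k" for j using that by simp
    then show ?thesis by (simp add: clinear_zero[OF clinear_cblinfun_apply])
  next
    case False
    then have s: "s > 0" using s0 by simp
    define y where "y = (\<lambda>j. complex_of_real (inverse s) *\<^sub>C x j)"
    have "(\<Sum>j<k. (norm (y j))\<^sup>2) = (inverse s)\<^sup>2 * s\<^sup>2"
      unfolding s2 sum_distrib_left using s by (simp add: y_def norm_scaleC norm_inverse power_mult_distrib)
    then have y: "(\<Sum>j<k. (norm (y j))\<^sup>2) = 1"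
      using s by (simp flip: power_mult_distrib)
    have "norm (\<Sum>j<k. cblinfun_apply (A i j) (y j)) = inverse s * norm (\<Sum>j<k. cblinfun_apply (A i j) (x j))" for i
      using s by (simp add: y_def clinear_scaleC[OF clinear_cblinfun_apply] norm_scaleC norm_inverse
          flip: scaleC_sum_right)
    then have "(\<Sum>i<k. (norm (\<Sum>j<k. cblinfun_apply (A i j) (y j)))\<^sup>2)
      = (inverse s)\<^sup>2 * (\<Sum>i<k. (norm (\<Sum>j<k. cblinfun_apply (A i j) (x j)))\<^sup>2)"
      by (simp add: power_mult_distrib sum_distrib_left)
    moreover have "(\<Sum>i<k. (norm (\<Sum>j<k. cblinfun_apply (A i j) (y j)))\<^sup>2) \<le> (op_matrix_norm k A)\<^sup>2"
      by (rule sqrt_le_D, rule op_matrix_norm_upper) (simp add: y)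
    ultimately have "(inverse s)\<^sup>2 * (\<Sum>i<k. (norm (\<Sum>j<k. cblinfun_apply (A i j) (x j)))\<^sup>2) \<le> (op_matrix_norm k A)\<^sup>2"
      by simp
    then show ?thesis
      unfolding s2[symmetric] using s by (simp add: field_simps)
  qed
qed

lemma scalar_operator_apply: "cblinfun_apply (c *\<^sub>C id_cblinfun) z = c * (z::complex)"
  by (simp add: scaleC_cblinfun.rep_eq id_cblinfun.rep_eq scaleC_complex_def)

lemma norm_scalar_operator: "norm (c *\<^sub>C (id_cblinfun :: complex \<Rightarrow>\<^sub>C\<^sub>L complex)) \<le> cmod c"
proof -
  have "norm (id_cblinfun :: complex \<Rightarrow>\<^sub>C\<^sub>L complex) \<le> 1"
    unfolding norm_cblinfun.rep_eq id_cblinfun.rep_eq by (rule onorm_bound) auto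
  then show ?thesis
    unfolding norm_scaleC using mult_left_mono[of _ 1 "cmod c"] by fastforce
qed

lemma scalar_matrix_norm_bound:
  "(\<Sum>i<k. (cmod (\<Sum>j<k. a i j * x j))\<^sup>2) \<le> (scalar_matrix_norm k a)\<^sup>2 * (\<Sum>j<k. (cmod (x j))\<^sup>2)"
  using op_matrix_norm_bound[where k = k and A = "\<lambda>i j. a i j *\<^sub>C (id_cblinfun :: complex \<Rightarrow>\<^sub>C\<^sub>L complex)" and x = x]
  unfolding scalar_matrix_norm_def scalar_operator_apply .

lemma scalar_matrix_norm_least:
  assumes "\<And>x. sqrt (\<Sum>j<k. (cmod (x j))\<^sup>2) \<le> 1 \<Longrightarrow> sqrt (\<Sum>i<k. (cmod (\<Sum>j<k. a i j * x j))\<^sup>2) \<le> B"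
  shows "scalar_matrix_norm k a \<le> B"
  unfolding scalar_matrix_norm_def
  by (rule op_matrix_norm_least) (use assms in \<open>simp only: scalar_operator_apply\<close>)

lemma scalar_matrix_norm_nonneg: "0 \<le> scalar_matrix_norm k a"
  unfolding scalar_matrix_norm_def by (rule op_matrix_norm_nonneg)

lemma scalar_matrix_norm_le_sum: "scalar_matrix_norm k a \<le> (\<Sum>i<k. \<Sum>j<k. cmod (a i j))"
  unfolding scalar_matrix_norm_def
  by (rule op_matrix_norm_least, rule order_trans[OF op_matrix_norm_sum_bound])
    (auto intro!: sum_mono norm_scalar_operator)

lemma MIN_norm_upper:
  fixes g :: "'w::complex_normed_vector \<Rightarrow>\<^sub>C\<^sub>L complex"
  assumes "norm g \<le> 1"
  shows "scalar_matrix_norm k (\<lambda>i j. cblinfun_apply g (v i j)) \<le> MIN_norm k v"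
  unfolding MIN_norm_def
proof (rule cSUP_upper)
  show "bdd_above ((\<lambda>g :: 'w \<Rightarrow>\<^sub>C\<^sub>L complex. scalar_matrix_norm k (\<lambda>i j. cblinfun_apply g (v i j))) ` {g. norm g \<le> 1})"
    by (rule bdd_aboveI2[where M = "\<Sum>i<k. \<Sum>j<k. norm (v i j)"])
      (auto intro!: order_trans[OF scalar_matrix_norm_le_sum] sum_mono contraction_apply)
qed (use assms in simp)

lemma MIN_norm_least:
  fixes v :: "nat \<Rightarrow> nat \<Rightarrow> 'w::complex_normed_vector"
  assumes "\<And>g :: 'w \<Rightarrow>\<^sub>C\<^sub>L complex. norm g \<le> 1 \<Longrightarrow> scalar_matrix_norm k (\<lambda>i j. cblinfun_apply g (v i j)) \<le> B"
  shows "MIN_norm k v \<le> B"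
  unfolding MIN_norm_def
proof (rule cSUP_least)
  show "{g :: 'w \<Rightarrow>\<^sub>C\<^sub>L complex. norm g \<le> 1} \<noteq> {}"
    by (auto intro!: exI[of _ 0])
qed (use assms in simp)

lemma MIN_norm_nonneg: "0 \<le> MIN_norm k (v :: nat \<Rightarrow> nat \<Rightarrow> 'w::complex_normed_vector)"
  by (rule order_trans[OF scalar_matrix_norm_nonneg MIN_norm_upper[of 0]]) simp

section \<open>Functionals on the two-dimensional space\<close>

lemma ell1_2_functional_exists:
  assumes "cmod l \<le> 1" "cmod u \<le> 1"
  obtains g where "norm g \<le> 1" "\<And>w. cblinfun_apply g w = l * coord1 w + u * coord2 w"
proof -
  define f where "f = (\<lambda>w. l * coord1 w + u * coord2 w)"
  have lin: "clinear f"
    by (simp add: clinear_def f_def plus_ell1_2_def scaleC_ell1_2_def scaleC_complex_def algebra_simps)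
  have b: "norm (f w) \<le> 1 * norm w" for w
  proof -
    have "norm (f w) \<le> cmod l * cmod (coord1 w) + cmod u * cmod (coord2 w)"
      unfolding f_def by (rule order_trans[OF norm_triangle_ineq]) (simp add: norm_mult)
    also have "\<dots> \<le> 1 * cmod (coord1 w) + 1 * cmod (coord2 w)"
      by (intro add_mono mult_right_mono assms) auto
    finally show ?thesis by (simp add: norm_ell1_2_def)
  qed
  show ?thesis
    using that[of "Cblinfun f"] Cblinfun_of_clinear[OF lin b] by (simp add: f_def)
qed

lemma ell1_2_functional_cases:
  assumes "norm g \<le> 1"
  obtains l u where "cmod l \<le> 1" "cmod u \<le> 1" "\<And>w. cblinfun_apply g w = l * coord1 w + u * coord2 w"
proof (rule that)
  show "cmod (cblinfun_apply g (Ell1 1 0)) \<le> 1" "cmod (cblinfun_apply g (Ell1 0 1)) \<le> 1"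
    using contraction_apply[OF assms, of "Ell1 1 0"] contraction_apply[OF assms, of "Ell1 0 1"]
    by (simp_all add: norm_ell1_2_def)
  fix w
  have "w = coord1 w *\<^sub>C Ell1 1 0 + coord2 w *\<^sub>C Ell1 0 1"
    by (simp add: plus_ell1_2_def scaleC_ell1_2_def)
  then have "cblinfun_apply g w = cblinfun_apply g (coord1 w *\<^sub>C Ell1 1 0 + coord2 w *\<^sub>C Ell1 0 1)"
    by simp
  then show "cblinfun_apply g w = cblinfun_apply g (Ell1 1 0) * coord1 w + cblinfun_apply g (Ell1 0 1) * coord2 w"
    by (simp add: clinear_add[OF clinear_cblinfun_apply] clinear_scaleC[OF clinear_cblinfun_apply]
        scaleC_complex_def mult.commute)
qed

text \<open>
  With \<open>r = \<bar>c\<bar>\<close> and \<open>s = sqrt (1 - r\<^sup>2)\<close>, the real number \<open>r\<close> is the midpoint of \<open>r + i s\<close> and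
  \<open>r - i s\<close>; then rotate by the phase of \<open>c\<close>.
\<close>

lemma disc_midpoint_of_circle:
  assumes "cmod c \<le> 1"
  obtains p q where "cmod p = 1" "cmod q = 1" "c = (p + q) / 2"
proof -
  define r where "r = cmod c"
  define s where "s = sqrt (1 - r\<^sup>2)"
  have r: "0 \<le> r" "r\<^sup>2 \<le> 1" using assms by (simp_all add: r_def power_le_one)
  then have s: "r\<^sup>2 + s\<^sup>2 = 1" by (simp add: s_def)
  have c: "c = sgn c * complex_of_real r \<or> c = 0"
    by (cases "c = 0") (simp_all add: r_def sgn_eq)
  define d where "d = (if c = 0 then 1 else sgn c)"
  have d: "cmod d = 1" "c = d * complex_of_real r"
    using c by (auto simp: d_def norm_sgn r_def)
  show ?thesis
  proof (rule that[of "d * Complex r s" "d * Complex r (- s)"])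
    show "cmod (d * Complex r s) = 1" "cmod (d * Complex r (- s)) = 1"
      using s unfolding norm_mult d(1) by (simp_all add: cmod_def)
    have "Complex r s + Complex r (- s) = 2 * complex_of_real r"
      by (simp add: complex_eq_iff)
    then show "c = (d * Complex r s + d * Complex r (- s)) / 2"
      by (simp add: d(2) flip: distrib_left)
  qed
qed

section \<open>Pencils of contractions with joint approximate eigenvectors\<close>

lemma norm_tendsto_of_approximate:
  fixes X Y :: "nat \<Rightarrow> 'a::real_normed_vector"
  assumes "(\<lambda>n. X n - Y n) \<longlonglongrightarrow> 0" "\<And>n. norm (Y n) = c"
  shows "(\<lambda>n. norm (X n)) \<longlonglongrightarrow> c"
proof (rule LIM_zero_cancel, rule Lim_null_comparison)
  have "norm (norm (X n) - c) \<le> norm (X n - Y n)" for n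
    using norm_triangle_ineq3[of "X n" "Y n"] by (simp add: assms(2))
  then show "\<forall>\<^sub>F n in sequentially. norm (norm (X n) - c) \<le> norm (X n - Y n)"
    by simp
  show "(\<lambda>n. norm (X n - Y n)) \<longlonglongrightarrow> 0"
    using assms(1) by (rule tendsto_norm_zero)
qed

text \<open>
  Since \<open>h n\<close> has norm one, the vector is asymptotically \<open>(l * p + u * q) *\<^sub>C h n\<close>.
\<close>

lemma pencil_norm_tendsto:
  fixes S T :: "'k::chilbert_space \<Rightarrow>\<^sub>C\<^sub>L 'k"
  assumes h: "\<And>n. norm (h n) = 1"
    and S: "(\<lambda>n. cblinfun_apply S (h n) - l *\<^sub>C h n) \<longlonglongrightarrow> 0"
    and T: "(\<lambda>n. cblinfun_apply T (h n) - u *\<^sub>C h n) \<longlonglongrightarrow> 0"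
  shows "(\<lambda>n. norm (p *\<^sub>C cblinfun_apply S (h n) + q *\<^sub>C cblinfun_apply T (h n))) \<longlonglongrightarrow> cmod (l * p + u * q)"
proof (rule norm_tendsto_of_approximate)
  have "(\<lambda>n. p *\<^sub>C (cblinfun_apply S (h n) - l *\<^sub>C h n) + q *\<^sub>C (cblinfun_apply T (h n) - u *\<^sub>C h n)) \<longlonglongrightarrow> p *\<^sub>C 0 + q *\<^sub>C 0"
    by (intro tendsto_add bounded_linear.tendsto[OF bounded_linear_scaleC] S T)
  moreover have "p *\<^sub>C (cblinfun_apply S (h n) - l *\<^sub>C h n) + q *\<^sub>C (cblinfun_apply T (h n) - u *\<^sub>C h n)
    = (p *\<^sub>C cblinfun_apply S (h n) + q *\<^sub>C cblinfun_apply T (h n)) - (l * p + u * q) *\<^sub>C h n" for n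
    by (simp add: scaleC_diff_right scaleC_scaleC scaleC_add_left mult.commute)
  ultimately show "(\<lambda>n. (p *\<^sub>C cblinfun_apply S (h n) + q *\<^sub>C cblinfun_apply T (h n)) - (l * p + u * q) *\<^sub>C h n) \<longlonglongrightarrow> 0"
    by simp
  show "norm ((l * p + u * q) *\<^sub>C h n) = cmod (l * p + u * q)" for n
    by (simp add: norm_scaleC h)
qed

text \<open>
  Test the operator matrix on the tuples \<open>x j *\<^sub>C h n\<close> and let \<open>n\<close> tend to infinity.
\<close>

lemma pencil_lower_bound:
  fixes S T :: "'k::chilbert_space \<Rightarrow>\<^sub>C\<^sub>L 'k"
  assumes h: "\<And>n. norm (h n) = 1"
    and S: "(\<lambda>n. cblinfun_apply S (h n) - l *\<^sub>C h n) \<longlonglongrightarrow> 0"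
    and T: "(\<lambda>n. cblinfun_apply T (h n) - u *\<^sub>C h n) \<longlonglongrightarrow> 0"
    and x: "sqrt (\<Sum>j<k. (cmod (x j))\<^sup>2) \<le> 1"
  shows "sqrt (\<Sum>i<k. (cmod (\<Sum>j<k. (l * a i j + u * b i j) * x j))\<^sup>2)
    \<le> op_matrix_norm k (\<lambda>i j. a i j *\<^sub>C S + b i j *\<^sub>C T)"
proof (rule LIMSEQ_le_const2)
  define p where "p = (\<lambda>i. \<Sum>j<k. a i j * x j)"
  define q where "q = (\<lambda>i. \<Sum>j<k. b i j * x j)"
  have pq: "(\<Sum>j<k. (l * a i j + u * b i j) * x j) = l * p i + u * q i" for i
    by (simp add: p_def q_def sum_distrib_left sum.distrib algebra_simps)
  have vec: "(\<Sum>j<k. cblinfun_apply (a i j *\<^sub>C S + b i j *\<^sub>C T) (x j *\<^sub>C h n))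
    = p i *\<^sub>C cblinfun_apply S (h n) + q i *\<^sub>C cblinfun_apply T (h n)" for i n
    by (simp add: p_def q_def plus_cblinfun.rep_eq scaleC_cblinfun.rep_eq scaleC_sum_left
        clinear_scaleC[OF clinear_cblinfun_apply] scaleC_scaleC sum.distrib)
  show "(\<lambda>n. sqrt (\<Sum>i<k. (norm (\<Sum>j<k. cblinfun_apply (a i j *\<^sub>C S + b i j *\<^sub>C T) (x j *\<^sub>C h n)))\<^sup>2))
    \<longlonglongrightarrow> sqrt (\<Sum>i<k. (cmod (\<Sum>j<k. (l * a i j + u * b i j) * x j))\<^sup>2)"
    unfolding pq vec by (intro tendsto_intros pencil_norm_tendsto[OF h S T])
  show "\<exists>N. \<forall>n\<ge>N. sqrt (\<Sum>i<k. (norm (\<Sum>j<k. cblinfun_apply (a i j *\<^sub>C S + b i j *\<^sub>C T) (x j *\<^sub>C h n)))\<^sup>2)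
    \<le> op_matrix_norm k (\<lambda>i j. a i j *\<^sub>C S + b i j *\<^sub>C T)"
    using x by (intro exI allI impI op_matrix_norm_upper) (simp add: norm_scaleC h)
qed

lemma pencil_matrix_norm_eq_MIN:
  fixes S T :: "'k::chilbert_space \<Rightarrow>\<^sub>C\<^sub>L 'k" and v :: "nat \<Rightarrow> nat \<Rightarrow> ell1_2"
  assumes contr: "norm S \<le> 1" "norm T \<le> 1"
    and joint: "\<And>l u. cmod l = 1 \<Longrightarrow> cmod u = 1 \<Longrightarrow> joint_approximate_eigenvalue S T l u"
  shows "op_matrix_norm k (\<lambda>i j. coord1 (v i j) *\<^sub>C S + coord2 (v i j) *\<^sub>C T) = MIN_norm k v"
proof (rule antisym)
  define A where "A = (\<lambda>i j. coord1 (v i j) *\<^sub>C S + coord2 (v i j) *\<^sub>C T)"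
  show "op_matrix_norm k A \<le> MIN_norm k v"
  proof (rule op_matrix_norm_least)
    fix x :: "nat \<Rightarrow> 'k" assume "sqrt (\<Sum>j<k. (norm (x j))\<^sup>2) \<le> 1"
    then have x: "(\<Sum>j<k. (norm (x j))\<^sup>2) \<le> 1" by simp
    have scalar: "(\<Sum>i<k. (cmod (\<Sum>j<k. (l * coord1 (v i j) + u * coord2 (v i j)) * y j))\<^sup>2)
        \<le> (MIN_norm k v)\<^sup>2 * (\<Sum>j<k. (cmod (y j))\<^sup>2)" if lu: "cmod l = 1" "cmod u = 1" for l u y
    proof -
      obtain g where g: "norm g \<le> 1" "\<And>w. cblinfun_apply g w = l * coord1 w + u * coord2 w"
        using ell1_2_functional_exists[of l u] lu by auto
      have "(\<Sum>i<k. (cmod (\<Sum>j<k. (l * coord1 (v i j) + u * coord2 (v i j)) * y j))\<^sup>2)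
        \<le> (scalar_matrix_norm k (\<lambda>i j. cblinfun_apply g (v i j)))\<^sup>2 * (\<Sum>j<k. (cmod (y j))\<^sup>2)"
        unfolding g(2) by (rule scalar_matrix_norm_bound)
      also have "\<dots> \<le> (MIN_norm k v)\<^sup>2 * (\<Sum>j<k. (cmod (y j))\<^sup>2)"
        by (intro mult_right_mono power_mono MIN_norm_upper g scalar_matrix_norm_nonneg sum_nonneg) simp
      finally show ?thesis .
    qed
    have "(\<Sum>i<k. (norm (\<Sum>j<k. cblinfun_apply (A i j) (x j)))\<^sup>2) \<le> (MIN_norm k v)\<^sup>2 * (\<Sum>j<k. (norm (x j))\<^sup>2)"
      unfolding A_def plus_cblinfun.rep_eq scaleC_cblinfun.rep_eq
      by (rule pencil_upper_bound[OF contr]) (rule scalar)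
    also have "\<dots> \<le> (MIN_norm k v)\<^sup>2 * 1"
      using x by (intro mult_left_mono) auto
    finally have "(\<Sum>i<k. (norm (\<Sum>j<k. cblinfun_apply (A i j) (x j)))\<^sup>2) \<le> (MIN_norm k v)\<^sup>2" by simp
    then show "sqrt (\<Sum>i<k. (norm (\<Sum>j<k. cblinfun_apply (A i j) (x j)))\<^sup>2) \<le> MIN_norm k v"
      by (intro real_le_lsqrt MIN_norm_nonneg)
  qed
  show "MIN_norm k v \<le> op_matrix_norm k A"
  proof (intro MIN_norm_least scalar_matrix_norm_least)
    fix g :: "ell1_2 \<Rightarrow>\<^sub>C\<^sub>L complex" and x :: "nat \<Rightarrow> complex"
    assume g: "norm g \<le> 1" and x: "sqrt (\<Sum>j<k. (cmod (x j))\<^sup>2) \<le> 1"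
    obtain l u where lu: "cmod l \<le> 1" "cmod u \<le> 1" "\<And>w. cblinfun_apply g w = l * coord1 w + u * coord2 w"
      using ell1_2_functional_cases[OF g] by blast
    \<comment> \<open>The matrix of \<open>g\<close> is the average of two matrices with unimodular coefficients.\<close>
    obtain l1 l2 where l: "cmod l1 = 1" "cmod l2 = 1" "l = (l1 + l2) / 2"
      using disc_midpoint_of_circle[OF lu(1)] by blast
    obtain u1 u2 where u: "cmod u1 = 1" "cmod u2 = 1" "u = (u1 + u2) / 2"
      using disc_midpoint_of_circle[OF lu(2)] by blast
    define y where "y = (\<lambda>l u i. \<Sum>j<k. (l * coord1 (v i j) + u * coord2 (v i j)) * x j)"
    have bound: "L2_set (\<lambda>i. cmod (y l u i)) {..<k} \<le> op_matrix_norm k A"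
      if circ: "cmod l = 1" "cmod u = 1" for l u
    proof -
      obtain h :: "nat \<Rightarrow> 'k" where "\<And>n. norm (h n) = 1"
        "(\<lambda>n. cblinfun_apply S (h n) - l *\<^sub>C h n) \<longlonglongrightarrow> 0" "(\<lambda>n. cblinfun_apply T (h n) - u *\<^sub>C h n) \<longlonglongrightarrow> 0"
        using joint[OF circ] unfolding joint_approximate_eigenvalue_def by blast
      from pencil_lower_bound[OF this x] show ?thesis
        unfolding L2_set_def y_def A_def .
    qed
    have avg: "(\<Sum>j<k. cblinfun_apply g (v i j) * x j) = (y l1 u1 i + y l2 u2 i) / 2" for i
      unfolding lu(3) l(3) u(3) y_def sum.distrib[symmetric] sum_divide_distrib
      by (intro sum.cong refl) (simp add: field_simps)
    have "sqrt (\<Sum>i<k. (cmod (\<Sum>j<k. cblinfun_apply g (v i j) * x j))\<^sup>2)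
      = L2_set (\<lambda>i. cmod ((y l1 u1 i + y l2 u2 i) / 2)) {..<k}"
      unfolding avg L2_set_def ..
    also have "\<dots> \<le> L2_set (\<lambda>i. cmod (y l1 u1 i) / 2 + cmod (y l2 u2 i) / 2) {..<k}"
      by (rule L2_set_mono) (use norm_triangle_ineq in \<open>auto simp: norm_divide add_divide_distrib[symmetric]\<close>)
    also have "\<dots> \<le> L2_set (\<lambda>i. cmod (y l1 u1 i) / 2) {..<k} + L2_set (\<lambda>i. cmod (y l2 u2 i) / 2) {..<k}"
      by (rule L2_set_triangle_ineq)
    also have "\<dots> = (L2_set (\<lambda>i. cmod (y l1 u1 i)) {..<k} + L2_set (\<lambda>i. cmod (y l2 u2 i)) {..<k}) / 2"
      using L2_set_left_distrib[of "1/2" "\<lambda>i. cmod (y l1 u1 i)" "{..<k}"]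
        L2_set_left_distrib[of "1/2" "\<lambda>i. cmod (y l2 u2 i)" "{..<k}"] by simp
    also have "\<dots> \<le> op_matrix_norm k A"
      using bound[OF l(1) u(1)] bound[OF l(2) u(2)] by simp
    finally show "sqrt (\<Sum>i<k. (cmod (\<Sum>j<k. cblinfun_apply g (v i j) * x j))\<^sup>2) \<le> op_matrix_norm k A" .
  qed
qed

text \<open>
  For the lower bound, choosing \<open>l\<close> and \<open>u\<close> to be the inverse phases of \<open>p\<close> and \<open>q\<close> makes \<open>l * p + u * q\<close> equal to
  \<open>\<bar>p\<bar> + \<bar>q\<bar>\<close>.
\<close>

lemma pencil_norm_eq:
  fixes S T :: "'k::chilbert_space \<Rightarrow>\<^sub>C\<^sub>L 'k"
  assumes contr: "norm S \<le> 1" "norm T \<le> 1"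
    and joint: "\<And>l u. cmod l = 1 \<Longrightarrow> cmod u = 1 \<Longrightarrow> joint_approximate_eigenvalue S T l u"
  shows "norm (p *\<^sub>C S + q *\<^sub>C T) = cmod p + cmod q"
proof (rule antisym)
  have "norm (p *\<^sub>C S + q *\<^sub>C T) \<le> cmod p * norm S + cmod q * norm T"
    by (rule order_trans[OF norm_triangle_ineq]) (simp add: norm_scaleC)
  also have "\<dots> \<le> cmod p * 1 + cmod q * 1"
    by (intro add_mono mult_left_mono contr) auto
  finally show "norm (p *\<^sub>C S + q *\<^sub>C T) \<le> cmod p + cmod q" by simp
  have phase: "\<exists>l. cmod l = 1 \<and> l * c = complex_of_real (cmod c)" for c
  proof (cases "c = 0")
    case False
    have "cnj c * c / complex_of_real (cmod c) = complex_of_real ((cmod c)\<^sup>2) / complex_of_real (cmod c)"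
      by (simp only: complex_norm_square mult.commute)
    also have "\<dots> = complex_of_real (cmod c)"
      using False by (simp add: power2_eq_square)
    finally show ?thesis
      using False by (intro exI[of _ "cnj c / complex_of_real (cmod c)"]) (simp add: norm_divide)
  qed (auto intro: exI[of _ 1])
  obtain l u where lu: "cmod l = 1" "l * p = complex_of_real (cmod p)" "cmod u = 1" "u * q = complex_of_real (cmod q)"
    using phase by metis
  obtain h :: "nat \<Rightarrow> 'k" where h: "\<And>n. norm (h n) = 1"
    "(\<lambda>n. cblinfun_apply S (h n) - l *\<^sub>C h n) \<longlonglongrightarrow> 0" "(\<lambda>n. cblinfun_apply T (h n) - u *\<^sub>C h n) \<longlonglongrightarrow> 0"
    using joint[OF lu(1,3)] unfolding joint_approximate_eigenvalue_def by blast
  have "cmod (l * p + u * q) \<le> norm (p *\<^sub>C S + q *\<^sub>C T)"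
  proof (rule LIMSEQ_le_const2[OF pencil_norm_tendsto[OF h]], intro exI allI impI)
    show "norm (p *\<^sub>C cblinfun_apply S (h n) + q *\<^sub>C cblinfun_apply T (h n)) \<le> norm (p *\<^sub>C S + q *\<^sub>C T)" for n
      using norm_cblinfun_apply[of "p *\<^sub>C S + q *\<^sub>C T" "h n"]
      by (simp add: plus_cblinfun.rep_eq scaleC_cblinfun.rep_eq h(1))
  qed
  moreover have "cmod (l * p + u * q) = cmod p + cmod q"
    unfolding lu(2,4) of_real_add[symmetric] norm_of_real by simp
  ultimately show "cmod p + cmod q \<le> norm (p *\<^sub>C S + q *\<^sub>C T)" by simp
qed

theorem mainTheorem11:
  fixes tensor :: "'h1::chilbert_space \<Rightarrow> 'h2::chilbert_space \<Rightarrow> 'k::chilbert_space"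
    and T1 :: "'h1 \<Rightarrow>\<^sub>C\<^sub>L 'h1" and T2 :: "'h2 \<Rightarrow>\<^sub>C\<^sub>L 'h2"
  assumes "hilbert_tensor_product tensor"
    and "norm T1 \<le> 1" and "norm T2 \<le> 1"
    and "sphere 0 1 \<subseteq> op_spectrum T1" and "sphere 0 1 \<subseteq> op_spectrum T2"
  shows "isometric (ell1_tensor_map tensor T1 T2) \<and>
    complete_isometry MIN_norm (induced_norm (ell1_tensor_map tensor T1 T2)) id \<and>
    complete_isometry MIN_norm op_matrix_norm (ell1_tensor_map tensor T1 T2)"
proof -
  define S where "S = op_tensor tensor T1 id_cblinfun"
  define T where "T = op_tensor tensor id_cblinfun T2"
  have contr: "norm S \<le> 1" "norm T \<le> 1"
    unfolding S_def T_def
    using op_tensor_contraction_left(1) op_tensor_contraction_right(1) assms by blast+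
  have joint: "joint_approximate_eigenvalue S T l u"
    if "cmod l = 1" "cmod u = 1" for l u
    unfolding S_def T_def by (rule tensor_joint_approximate_eigenvalue[OF assms that])
  have map: "ell1_tensor_map tensor T1 T2 w = coord1 w *\<^sub>C S + coord2 w *\<^sub>C T" for w
    by (simp add: ell1_tensor_map_def S_def T_def)
  have eq: "op_matrix_norm k (\<lambda>i j. ell1_tensor_map tensor T1 T2 (v i j)) = MIN_norm k v" for k v
    unfolding map by (rule pencil_matrix_norm_eq_MIN[OF contr joint])
  have "isometric (ell1_tensor_map tensor T1 T2)"
    unfolding isometric_def map norm_ell1_2_def using pencil_norm_eq[OF contr joint] by blast
  moreover have "clinear (ell1_tensor_map tensor T1 T2)"
    unfolding clinear_def map
    by (simp add: plus_ell1_2_def scaleC_ell1_2_def scaleC_add_left scaleC_add_right scaleC_scaleC add_ac)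
  moreover have "clinear (id :: ell1_2 \<Rightarrow> ell1_2)"
    by (simp add: clinear_def)
  ultimately show ?thesis
    unfolding complete_isometry_def induced_norm_def using eq by simp
qed

end
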